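(* For every integer $n \geq 0$, $\mathsf{M}(P_{2n+2} \times P_3) \simeq \mathbb{S}^{2n+1}$ and $\mathsf{M}(P_{2n+3} \times P_3) \simeq \bigvee_{2^{n+2}-1} \mathbb{S}^{2n+1}$.
   Context: For $k \geq 1$, $P_k$ denotes the path graph with vertices $v_1,\dots,v_k$ and edges $v_iv_{i+1}$, $1 \le i \le k-1$. The categorical product $G \times H$ of graphs $G,H$ has vertex set $V(G)\times V(H)$, with $(u,v)$ adjacent to $(u',v')$ if and only if $uu' \in E(G)$ and $vv' \in E(H)$. The matching complex $\mathsf{M}(G)$ is the simplicial complex whose vertices are the edges of $G$ and whose simplices are the sets of pairwise disjoint edges of $G$. $\bigvee_k \mathbb{S}^d$ denotes a wedge of $k$ copies of the $d$-sphere. *)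

theory Defs
  imports "HOL-Analysis.Analysis"
begin

section \<open>Graphs\<close>

text \<open>Edges of an undirected graph are the unordered pairs \<open>{u, v}\<close> of their endpoints.\<close>

record 'a ugraph =
  verts :: "'a set"
  edges :: "'a set set"

definition path_graph :: "nat \<Rightarrow> nat ugraph" where
  "path_graph k = \<lparr> verts = {1..k}, edges = {{i, i + 1} | i. 1 \<le> i \<and> i < k} \<rparr>"

definition categorical_product :: "'a ugraph \<Rightarrow> 'b ugraph \<Rightarrow> ('a \<times> 'b) ugraph" where
  "categorical_product G H =
     \<lparr> verts = verts G \<times> verts H,
       edges = {{(u, v), (u', v')} | u v u' v'. {u, u'} \<in> edges G \<and> {v, v'} \<in> edges H} \<rparr>"

section \<open>Simplicial complexes\<close>

text \<open>An abstract simplicial complex is given by its set of simplices; the empty simplex may be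
  included and does not contribute to the realization.\<close>

definition matching_complex :: "'a ugraph \<Rightarrow> 'a set set set" where
  "matching_complex G = {M. M \<subseteq> edges G \<and> pairwise disjnt M}"

lemma matching_complex_downward_closed:
  "M \<in> matching_complex G \<Longrightarrow> N \<subseteq> M \<Longrightarrow> N \<in> matching_complex G"
  by (auto simp: matching_complex_def intro: pairwise_subset)

text \<open>Points are given by barycentric coordinates: nonnegative functions on the vertices whose
  support is a simplex and whose values add up to 1. Every support is finite, since otherwise
  the sum below is 0. The topology is that of coordinatewise convergence, which is the usual
  topology of the realization if the complex is finite, but not in general.\<close>

definition geometric_realization :: "'a set set \<Rightarrow> ('a \<Rightarrow> real) topology" where
  "geometric_realization K =
     subtopology (powertop_real UNIV)
       {x. (\<forall>v. 0 \<le> x v) \<and> {v. x v \<noteq> 0} \<in> K \<and> (\<Sum>v | x v \<noteq> 0. x v) = 1}"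

section \<open>Wedges\<close>

text \<open>The wedge of the pointed spaces \<open>(X i, p i)\<close>, \<open>i \<in> I\<close>, is the disjoint union with all
  basepoints identified. The common basepoint is represented by \<open>None\<close>, every other point
  by itself; the empty wedge is a single point.\<close>

definition wedge_proj :: "('i \<Rightarrow> 'a) \<Rightarrow> 'i \<times> 'a \<Rightarrow> ('i \<times> 'a) option" where
  "wedge_proj p = (\<lambda>(i, x). if x = p i then None else Some (i, x))"

definition wedge_sum ::
    "('i \<Rightarrow> 'a topology) \<Rightarrow> ('i \<Rightarrow> 'a) \<Rightarrow> 'i set \<Rightarrow> ('i \<times> 'a) option topology" where
  "wedge_sum X p I = topology (\<lambda>U.
     U \<subseteq> insert None (wedge_proj p ` topspace (sum_topology X I)) \<and>
     openin (sum_topology X I) {z \<in> topspace (sum_topology X I). wedge_proj p z \<in> U})"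

lemma istopology_wedge_sum:
  "istopology (\<lambda>U.
     U \<subseteq> insert None (wedge_proj p ` topspace (sum_topology X I)) \<and>
     openin (sum_topology X I) {z \<in> topspace (sum_topology X I). wedge_proj p z \<in> U})"
proof -
  let ?S = "sum_topology X I"
  have int: "{z \<in> topspace ?S. wedge_proj p z \<in> U \<inter> V} =
      {z \<in> topspace ?S. wedge_proj p z \<in> U} \<inter> {z \<in> topspace ?S. wedge_proj p z \<in> V}" for U V
    by blast
  have un: "{z \<in> topspace ?S. wedge_proj p z \<in> \<Union>\<K>} =
      (\<Union>U\<in>\<K>. {z \<in> topspace ?S. wedge_proj p z \<in> U})" for \<K>
    by blast
  show ?thesis
    unfolding istopology_def int un by blast
qed

lemma openin_wedge_sum:
  "openin (wedge_sum X p I) U \<longleftrightarrow>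
     U \<subseteq> insert None (wedge_proj p ` topspace (sum_topology X I)) \<and>
     openin (sum_topology X I) {z \<in> topspace (sum_topology X I). wedge_proj p z \<in> U}"
  unfolding wedge_sum_def topology_inverse'[OF istopology_wedge_sum] ..

lemma topspace_wedge_sum:
  "topspace (wedge_sum X p I) = insert None (wedge_proj p ` topspace (sum_topology X I))"
proof
  show "topspace (wedge_sum X p I) \<subseteq> insert None (wedge_proj p ` topspace (sum_topology X I))"
    using openin_topspace[of "wedge_sum X p I"] unfolding openin_wedge_sum by blast
  have "{z \<in> topspace (sum_topology X I).
      wedge_proj p z \<in> insert None (wedge_proj p ` topspace (sum_topology X I))} =
      topspace (sum_topology X I)"
    by blast
  then have "openin (wedge_sum X p I) (insert None (wedge_proj p ` topspace (sum_topology X I)))"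
    unfolding openin_wedge_sum by (metis openin_topspace order_refl)
  then show "insert None (wedge_proj p ` topspace (sum_topology X I)) \<subseteq> topspace (wedge_sum X p I)"
    by (rule openin_subset)
qed

lemma quotient_map_wedge_proj:
  assumes "i \<in> I" and "p i \<in> topspace (X i)"
  shows "quotient_map (sum_topology X I) (wedge_sum X p I) (wedge_proj p)"
proof -
  have "(i, p i) \<in> topspace (sum_topology X I)"
    using assms by simp
  moreover have "wedge_proj p (i, p i) = None"
    by (simp add: wedge_proj_def)
  ultimately have "None \<in> wedge_proj p ` topspace (sum_topology X I)"
    by (metis imageI)
  then have img: "insert None (wedge_proj p ` topspace (sum_topology X I)) =
      wedge_proj p ` topspace (sum_topology X I)"
    by blast
  show ?thesis
    unfolding quotient_map_def topspace_wedge_sum openin_wedge_sum img by blast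
qed

definition nsphere_basepoint :: "nat \<Rightarrow> real" where
  "nsphere_basepoint = (\<lambda>i. if i = 0 then 1 else 0)"

lemma nsphere_basepoint_in: "nsphere_basepoint \<in> topspace (nsphere d)"
  by (simp add: nsphere nsphere_basepoint_def if_distrib[of "\<lambda>x. x ^ 2"] cong: if_cong)

definition wedge_of_spheres :: "nat \<Rightarrow> nat \<Rightarrow> (nat \<times> (nat \<Rightarrow> real)) option topology" where
  "wedge_of_spheres k d = wedge_sum (\<lambda>_. nsphere d) (\<lambda>_. nsphere_basepoint) {..<k}"

end

(* A set F of facets of dimension d whose removal leaves a contractible complex D exhibits a finite
   complex K as a wedge of card F spheres: a contraction of D extends to a homotopy of K, so K is
   homotopy equivalent to K / D. Such an F is found by discrete Morse theory: if F' works for the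
   link of v and F'' for the deletion of v, then the sets in F' with v added, together with F'',
   work for the whole complex.

   A component of P_m x P_3 is a chain of vertices x_i, where x_i is joined to two pairs
   {y_i, z_i} and {y_(i+1), z_(i+1)}, possibly without the first or the last pair. If a pair is
   missing at an end of the chain, folding from that end leaves disjoint paths with two edges,
   each of which suspends the matching complex. If no pair is missing, let f(a) be the number of
   critical facets of the chain x_0, ..., x_(a-1). The links of the two outermost edges are chains
   of length a - 1, and deleting both edges leaves a chain with a missing pair, so that
   f(a) = 2 f(a - 1) + 1. *)
theory Submission
  imports Defs
begin

section \<open>Realizations of finite complexes\<close>

text \<open>Collapsibility and critical facets are defined for arbitrary families of sets, so the
  recursion through links and deletions is pure combinatorics. Topology converts the final count
  once, with an explicit map K -> K / D.

  That conversion needs the critical sets to be maximal simplices, and they are recognised by size: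
  every edge of the product contains a vertex of the middle row, so counting these vertices bounds
  all matchings. The obstacle is P_(2n+3) x P_3, where one component has n+2 middle vertices and
  admits matchings that are too large by one. It is therefore folded by homotopy equivalences of
  realizations before any facets are counted.

  The recursion starts from the empty edge set, whose only critical facet is the empty matching, so
  f(0) = 1 and f(a) = 2^(a+1) - 1. In P_(2n+2) x P_3 each component lacks one end pair and folds to
  n+1 paths, whence a single sphere. In P_(2n+3) x P_3 one component lacks both end pairs, while the
  other lacks none and has n+1 middle vertices, whence a = n+1.\<close>

definition finite_complex :: "'a set set \<Rightarrow> bool" where
  "finite_complex K \<longleftrightarrow> finite (\<Union>K) \<and> (\<forall>\<sigma>\<in>K. \<forall>\<rho>. \<rho> \<subseteq> \<sigma> \<longrightarrow> \<rho> \<in> K)"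

lemma finite_complexD:
  assumes "finite_complex K"
  shows "finite (\<Union>K)" "\<And>\<sigma> \<rho>. \<sigma> \<in> K \<Longrightarrow> \<rho> \<subseteq> \<sigma> \<Longrightarrow> \<rho> \<in> K" "\<And>\<sigma>. \<sigma> \<in> K \<Longrightarrow> finite \<sigma>" "finite K"
proof -
  show f: "finite (\<Union>K)" "\<And>\<sigma> \<rho>. \<sigma> \<in> K \<Longrightarrow> \<rho> \<subseteq> \<sigma> \<Longrightarrow> \<rho> \<in> K"
    using assms by (auto simp: finite_complex_def)
  show "\<And>\<sigma>. \<sigma> \<in> K \<Longrightarrow> finite \<sigma>"
    using f(1) by (meson Union_upper finite_subset)
  show "finite K"
    using f(1) finite_UnionD by blast
qed

lemma in_realization_iff:
  assumes "finite V" and "\<Union>K \<subseteq> V"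
  shows "x \<in> topspace (geometric_realization K) \<longleftrightarrow>
    (\<forall>v. 0 \<le> x v) \<and> {v. x v \<noteq> 0} \<in> K \<and> sum x V = 1"
proof -
  have "sum x {v. x v \<noteq> 0} = sum x V" if "{v. x v \<noteq> 0} \<in> K"
    using that assms by (intro sum.mono_neutral_left) auto
  then show ?thesis
    by (auto simp: geometric_realization_def)
qed

lemma realizationD:
  assumes "x \<in> topspace (geometric_realization K)"
  shows "0 \<le> x v" "{v. x v \<noteq> 0} \<in> K"
  using assms by (auto simp: geometric_realization_def)

lemma continuous_map_realization_coordinate:
  "continuous_map (geometric_realization K) euclideanreal (\<lambda>x. x v)"
  unfolding geometric_realization_def
  by (intro continuous_map_from_subtopology continuous_map_product_projection) auto

lemma continuous_map_into_realization:
  "continuous_map X (geometric_realization K) f \<longleftrightarrow>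
    (\<forall>v. continuous_map X euclideanreal (\<lambda>z. f z v)) \<and>
    f \<in> topspace X \<rightarrow> topspace (geometric_realization K)"
  unfolding geometric_realization_def continuous_map_in_subtopology continuous_map_componentwise_UNIV
  by (auto simp: Pi_iff image_subset_iff)

lemma continuous_map_prod_realization_coordinate:
  "continuous_map (prod_topology T (geometric_realization K)) euclideanreal (\<lambda>z. snd z v)"
  using continuous_map_compose[OF continuous_map_snd continuous_map_realization_coordinate]
  by (simp add: o_def)

lemma continuous_map_prod_interval_fst:
  "continuous_map (prod_topology (top_of_set S) X) euclidean fst"
  using continuous_map_fst[of "top_of_set S" X] continuous_map_into_fulltopology by blast

lemma continuous_map_Min:
  fixes f :: "'b \<Rightarrow> 'a \<Rightarrow> real"
  assumes "finite A" "A \<noteq> {}" and "\<And>a. a \<in> A \<Longrightarrow> continuous_map X euclideanreal (\<lambda>x. f x a)"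
  shows "continuous_map X euclideanreal (\<lambda>x. Min (f x ` A))"
  using assms
  by (induction A rule: finite_ne_induct) (auto intro: continuous_map_real_min)

text \<open>Continuous surjections from a compact space onto a Hausdorff space are quotient maps;
  this supplies the compact side. The realization is a closed part of a cube.\<close>

lemma compact_realization:
  assumes K: "finite_complex K"
  shows "compact_space (geometric_realization K)"
proof -
  define V where "V = \<Union>K"
  have V: "finite V" using finite_complexD(1)[OF K] by (simp add: V_def)
  let ?P = "powertop_real UNIV :: ('a \<Rightarrow> real) topology"
  let ?B = "PiE UNIV (\<lambda>v::'a. {0..1::real})"
  have cB: "compactin ?P ?B"
    by (subst compactin_PiE) auto
  have cont: "continuous_map ?P euclideanreal (\<lambda>x. x v)" for v
    by (intro continuous_map_product_projection) auto
  have cl1: "closedin ?P {x. x v = c}" for v c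
    using closedin_continuous_map_preimage[OF cont, of "{c}" v] by simp
  have cl2: "closedin ?P {x. sum x V = 1}"
  proof -
    have "continuous_map ?P euclideanreal (\<lambda>x. sum x V)"
      using V cont by (intro continuous_map_sum) auto
    from closedin_continuous_map_preimage[OF this, of "{1}"] show ?thesis by simp
  qed
  \<comment> \<open>By closure under subsets, having support in \<open>K\<close> means vanishing
    outside some simplex; as \<open>K\<close> is finite, this is a finite union of closed
    sets.\<close>
  have cl3: "closedin ?P (\<Union>\<sigma>\<in>K. {x. \<forall>v\<in>-\<sigma>. x v = 0})"
  proof (intro closedin_Union ballI)
    show "finite ((\<lambda>\<sigma>. {x. \<forall>v\<in>-\<sigma>. x v = 0}) ` K)"
      using finite_complexD(4)[OF K] by simp
  next
    fix S :: "('a \<Rightarrow> real) set"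
    assume "S \<in> (\<lambda>\<sigma>. {x. \<forall>v\<in>-\<sigma>. x v = 0}) ` K"
    then obtain \<sigma> where S: "S = {x. \<forall>v\<in>-\<sigma>. x v = 0}" by blast
    show "closedin ?P S"
    proof (cases "-\<sigma> = {}")
      case True
      then have "S = topspace ?P" using S by auto
      then show ?thesis by (simp only: closedin_topspace)
    next
      case False
      have "S = (\<Inter>v\<in>-\<sigma>. {x. x v = 0})" using S by auto
      then show ?thesis using False cl1 by (auto intro!: closedin_INT)
    qed
  qed
  have eq: "topspace (geometric_realization K) =
     ?B \<inter> ({x. sum x V = 1} \<inter> (\<Union>\<sigma>\<in>K. {x. \<forall>v\<in>-\<sigma>. x v = 0}))" (is "?L = ?R")
  proof (intro equalityI subsetI)
    fix x assume "x \<in> ?L"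
    then have x: "\<forall>v. 0 \<le> x v" "{v. x v \<noteq> 0} \<in> K" "sum x V = 1"
      using in_realization_iff[OF V, of K x] by (auto simp: V_def)
    have "x v \<le> 1" for v
    proof (cases "v \<in> V")
      case True
      then have "x v \<le> sum x V" using V x(1) by (intro member_le_sum) auto
      then show ?thesis using x by simp
    next
      case False
      then have "x v = 0" using x(2) by (auto simp: V_def)
      then show ?thesis by simp
    qed
    moreover have "x \<in> (\<Union>\<sigma>\<in>K. {x. \<forall>v\<in>-\<sigma>. x v = 0})"
      using x(2) by (intro UN_I[of "{v. x v \<noteq> 0}"]) auto
    ultimately show "x \<in> ?R" using x by auto
  next
    fix x assume x: "x \<in> ?R"
    then obtain \<sigma> where "\<sigma> \<in> K" "\<forall>v\<in>-\<sigma>. x v = 0" by auto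
    then have "{v. x v \<noteq> 0} \<in> K"
      by (rule_tac finite_complexD(2)[OF K, of \<sigma>]) auto
    then show "x \<in> ?L"
      using x in_realization_iff[OF V, of K x] by (auto simp: V_def PiE_def Pi_def)
  qed
  have "compactin ?P (topspace (geometric_realization K))"
    unfolding eq by (intro compact_Int_closedin[OF cB] closedin_Int cl2 cl3)
  moreover have "geometric_realization K = subtopology ?P (topspace (geometric_realization K))"
    by (simp add: geometric_realization_def)
  ultimately show ?thesis
    by (metis compact_space_subtopology)
qed

text \<open>Mass flows from \<open>\<tau>\<close> to \<open>w\<close>: each vertex of
  \<open>\<tau>\<close> gives up the least coordinate \<open>m x\<close>. Where \<open>m x\<close>
  is positive the support contains \<open>\<tau>\<close>, so the cone condition admits
  \<open>w\<close>; where it is zero, that is on the target complex, nothing moves. At time 1 some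
  coordinate in \<open>\<tau>\<close> has vanished.\<close>

lemma collapse_deformation:
  assumes K: "finite_complex K" and \<tau>: "\<tau> \<noteq> {}" "w \<notin> \<tau>" "finite \<tau>"
    and cone: "\<And>\<sigma>. \<sigma> \<in> K \<Longrightarrow> \<tau> \<subseteq> \<sigma> \<Longrightarrow> insert w \<sigma> \<in> K"
  shows "geometric_realization K homotopy_equivalent_space
         geometric_realization {\<sigma> \<in> K. \<not> \<tau> \<subseteq> \<sigma>}"
proof -
  let ?K' = "{\<sigma> \<in> K. \<not> \<tau> \<subseteq> \<sigma>}"
  define V where "V = insert w (\<Union>K \<union> \<tau>)"
  have V: "finite V" "\<Union>K \<subseteq> V" "\<Union>?K' \<subseteq> V" "\<tau> \<subseteq> V" "w \<in> V"
    using finite_complexD(1)[OF K] \<tau> by (auto simp: V_def)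
  define m :: "('a \<Rightarrow> real) \<Rightarrow> real" where "m x = Min (x ` \<tau>)" for x
  \<comment> \<open>\<open>w\<close> receives what the \<open>card \<tau>\<close> vertices lose, so
    the total mass stays 1.\<close>
  define c :: "'a \<Rightarrow> real" where
    "c v = (if v = w then real (card \<tau>) else if v \<in> \<tau> then -1 else 0)" for v
  define h where "h = (\<lambda>(t::real, x) v. x v + t * m x * c v)"
  have sum_c: "sum c V = 0"
  proof -
    have "sum c V = sum c (insert w \<tau>)"
      using V by (intro sum.mono_neutral_right) (auto simp: c_def)
    also have "\<dots> = 0"
    proof -
      have "sum c \<tau> = (\<Sum>v\<in>\<tau>. -1)"
        using \<tau> by (intro sum.cong) (auto simp: c_def)
      then show ?thesis using \<tau> by (simp add: c_def)
    qed
    finally show ?thesis .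
  qed
  have m_le: "m x \<le> x v" if "v \<in> \<tau>" for x v
    using that \<tau> by (auto simp: m_def)
  have m_att: "\<exists>v\<in>\<tau>. m x = x v" for x
  proof -
    have "m x \<in> x ` \<tau>" unfolding m_def using \<tau> by (intro Min_in) auto
    then show ?thesis by blast
  qed
  have h_in: "h (t, x) \<in> topspace (geometric_realization K)"
    if x: "x \<in> topspace (geometric_realization K)" and t: "0 \<le> t" "t \<le> 1" for t x
  proof -
    have x0: "0 \<le> x v" for v using realizationD(1)[OF x] .
    have m0: "0 \<le> m x" using m_att[of x] x0 by metis
    have "0 \<le> h (t, x) v" for v
    proof -
      have "t * m x \<le> m x" using m0 t by (simp add: mult_left_le_one_le)
      then show ?thesis
        using m_le[of v x] x0[of v] m0 t by (auto simp: h_def c_def)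
    qed
    moreover have "{v. h (t, x) v \<noteq> 0} \<in> K"
    proof (cases "m x = 0")
      case True
      then show ?thesis using realizationD(2)[OF x] by (simp add: h_def)
    next
      case False
      then have sub: "\<tau> \<subseteq> {v. x v \<noteq> 0}" using m_le[of _ x] m0 by force
      then have "insert w {v. x v \<noteq> 0} \<in> K" using cone realizationD(2)[OF x] by blast
      moreover have "{v. h (t, x) v \<noteq> 0} \<subseteq> insert w {v. x v \<noteq> 0}"
        using sub by (auto simp: h_def c_def split: if_splits)
      ultimately show ?thesis using finite_complexD(2)[OF K] by blast
    qed
    moreover have "sum (h (t, x)) V = 1"
      using x in_realization_iff[OF V(1,2)] sum_c
      by (simp add: h_def sum.distrib flip: sum_distrib_left)
    ultimately show ?thesis using in_realization_iff[OF V(1,2)] by blast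
  qed
  have h1: "h (1, x) \<in> topspace (geometric_realization ?K')"
    if x: "x \<in> topspace (geometric_realization K)" for x
  proof -
    obtain v where v: "v \<in> \<tau>" "m x = x v" using m_att by blast
    then have "h (1, x) v = 0" using \<tau> by (auto simp: h_def c_def)
    then have "\<not> \<tau> \<subseteq> {v. h (1, x) v \<noteq> 0}" using v by auto
    then show ?thesis
      using h_in[OF x, of 1] in_realization_iff[OF V(1,2)] in_realization_iff[OF V(1,3)] by auto
  qed
  have sub: "topspace (geometric_realization ?K') \<subseteq> topspace (geometric_realization K)"
    using in_realization_iff[OF V(1,2)] in_realization_iff[OF V(1,3)] by auto
  have hfix: "h (t, x) = x" if x: "x \<in> topspace (geometric_realization ?K')" for t x
  proof -
    have "\<not> \<tau> \<subseteq> {v. x v \<noteq> 0}" using realizationD(2)[OF x] by auto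
    then obtain v where v: "v \<in> \<tau>" "x v = 0" by auto
    moreover have "0 \<le> m x" using m_att[of x] realizationD(1)[OF x] by metis
    ultimately have "m x = 0" using m_le[OF v(1), of x] by simp
    then show ?thesis by (simp add: h_def)
  qed
  have cm: "continuous_map (prod_topology (top_of_set {0..1}) (geometric_realization K))
      euclideanreal (\<lambda>z. m (snd z))"
    unfolding m_def using \<tau>
    by (intro continuous_map_Min continuous_map_prod_realization_coordinate) auto
  have ch: "continuous_map (prod_topology (top_of_set {0..1}) (geometric_realization K))
      (geometric_realization K) h"
    unfolding continuous_map_into_realization
  proof (intro conjI allI funcsetI)
    fix v
    have "continuous_map (prod_topology (top_of_set {0..1}) (geometric_realization K)) euclideanreal
        (\<lambda>z. snd z v + fst z * m (snd z) * c v)"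
      by (intro continuous_intros continuous_map_prod_realization_coordinate
          continuous_map_prod_interval_fst cm)
    then show "continuous_map (prod_topology (top_of_set {0..1}) (geometric_realization K))
        euclideanreal (\<lambda>z. h z v)"
      by (simp add: h_def case_prod_beta)
  qed (auto intro: h_in)
  have hom: "homotopic_with (\<lambda>x. True) (geometric_realization K) (geometric_realization K)
      id (\<lambda>x. h (1, x))"
    unfolding homotopic_with_def
    by (intro exI[of _ h] conjI) (use ch in \<open>auto simp: h_def\<close>)
  show ?thesis
  proof (rule deformation_retraction_imp_homotopy_equivalent_space)
    show "homotopic_with (\<lambda>x. True) (geometric_realization K) (geometric_realization K)
        (id \<circ> (\<lambda>x. h (1, x))) id"
      using hom by (simp add: homotopic_with_sym)
    have "continuous_map (geometric_realization K) (geometric_realization K) (\<lambda>x. h (1, x))"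
      using homotopic_with_imp_continuous_maps[OF hom] by blast
    then have "continuous_map (geometric_realization K) (geometric_realization ?K') (\<lambda>x. h (1, x))"
      using h1 unfolding continuous_map_into_realization by auto
    moreover have "continuous_map (geometric_realization ?K') (geometric_realization K) id"
      unfolding continuous_map_into_realization
      using sub continuous_map_realization_coordinate by auto
    ultimately show "retraction_maps (geometric_realization K) (geometric_realization ?K')
        (\<lambda>x. h (1, x)) id"
      using hfix by (auto simp: retraction_maps_def)
  qed
qed

section \<open>Collapsibility\<close>

definition link :: "'a \<Rightarrow> 'a set set \<Rightarrow> 'a set set" where
  "link v K = {\<sigma>. v \<notin> \<sigma> \<and> insert v \<sigma> \<in> K}"

definition deletion :: "'a \<Rightarrow> 'a set set \<Rightarrow> 'a set set" where
  "deletion v K = {\<sigma> \<in> K. v \<notin> \<sigma>}"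

text \<open>Meant for arbitrary families, since a link or deletion stripped of its critical sets
  need not be closed under subsets. A step removes everything above \<open>\<tau>\<close> at once,
  which amounts to pairing \<open>\<sigma>\<close> with \<open>insert w \<sigma>\<close>. The empty
  family counts as a cone.\<close>

inductive collapsible :: "'a set set \<Rightarrow> bool" where
  cone: "(\<And>\<sigma>. \<sigma> \<in> K \<Longrightarrow> insert w \<sigma> \<in> K) \<Longrightarrow> collapsible K"
| step: "\<tau> \<noteq> {} \<Longrightarrow> finite \<tau> \<Longrightarrow> w \<notin> \<tau> \<Longrightarrow> (\<And>\<sigma>. \<sigma> \<in> K \<Longrightarrow> \<tau> \<subseteq> \<sigma> \<Longrightarrow> insert w \<sigma> \<in> K) \<Longrightarrow>
    collapsible {\<sigma> \<in> K. \<not> \<tau> \<subseteq> \<sigma>} \<Longrightarrow> collapsible K"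

text \<open>A collapse of the link of \<open>v\<close> along \<open>\<tau>\<close> is a collapse of the whole complex along
  \<open>insert v \<tau>\<close>.\<close>

lemma collapsible_link_deletion:
  assumes "collapsible (link v K)" and "collapsible (deletion v K)"
  shows "collapsible K"
  using assms
proof (induction "link v K" arbitrary: K rule: collapsible.induct)
  case (cone w)
  show ?case
  proof (cases "w = v \<or> link v K = {}")
    case True
    then have "link v K = {}" using cone.hyps by (auto simp: link_def)
    then have "v \<notin> \<sigma>" if "\<sigma> \<in> K" for \<sigma>
      using that by (auto simp: link_def dest: spec[of _ "\<sigma> - {v}"] simp: insert_absorb)
    then have "deletion v K = K" by (auto simp: deletion_def)
    then show ?thesis using cone.prems by simp
  next
    case False
    \<comment> \<open>The link being a cone with apex \<open>w\<close>, a single step along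
      \<open>{v}\<close> removes every set through \<open>v\<close> and leaves the deletion.\<close>
    have "insert w \<sigma> \<in> K" if "\<sigma> \<in> K" "{v} \<subseteq> \<sigma>" for \<sigma>
    proof -
      have "\<sigma> - {v} \<in> link v K" using that by (auto simp: link_def insert_absorb)
      then have "insert v (insert w (\<sigma> - {v})) \<in> K"
        using cone.hyps[of "\<sigma> - {v}"] by (simp add: link_def)
      moreover have "insert v (insert w (\<sigma> - {v})) = insert w \<sigma>" using that by auto
      ultimately show ?thesis by simp
    qed
    moreover have "{\<sigma> \<in> K. \<not> {v} \<subseteq> \<sigma>} = deletion v K" by (auto simp: deletion_def)
    ultimately show ?thesis
      using False cone.prems by (intro collapsible.step[of "{v}" w K]) auto
  qed
next
  case (step \<tau> w)
  let ?K' = "{\<sigma> \<in> K. \<not> insert v \<tau> \<subseteq> \<sigma>}"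
  have L: "link v ?K' = {\<sigma> \<in> link v K. \<not> \<tau> \<subseteq> \<sigma>}" if "v \<notin> \<tau>"
    using that by (auto simp: link_def)
  have D: "deletion v ?K' = deletion v K" by (auto simp: deletion_def)
  have ins: "\<sigma> - {v} \<in> link v K" if "\<sigma> \<in> K" "v \<in> \<sigma>" for \<sigma>
    using that by (auto simp: link_def insert_absorb)
  show ?case
  \<comment> \<open>In the degenerate case no member of the link contains \<open>\<tau>\<close>,
    because members of the link avoid \<open>v\<close>, and so would
    \<open>insert w \<sigma>\<close>. The step then removes nothing.\<close>
  proof (cases "v = w \<or> v \<in> \<tau>")
    case True
    have "\<not> \<tau> \<subseteq> \<sigma>" if "\<sigma> \<in> link v K" for \<sigma>
      using that step.hyps(4)[OF that] True by (auto simp: link_def)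
    then have "link v K = {\<sigma> \<in> link v K. \<not> \<tau> \<subseteq> \<sigma>}" by blast
    then show ?thesis using step.hyps(6) step.prems by simp
  next
    case False
    have "collapsible ?K'"
      using step.hyps(6)[of ?K'] L D False step.prems by simp
    moreover have "insert w \<sigma> \<in> K" if "\<sigma> \<in> K" "insert v \<tau> \<subseteq> \<sigma>" for \<sigma>
    proof -
      have "insert w (\<sigma> - {v}) \<in> link v K"
        using that ins[of \<sigma>] False by (intro step.hyps(4)) auto
      then have "insert v (insert w (\<sigma> - {v})) \<in> K" by (simp add: link_def)
      moreover have "insert v (insert w (\<sigma> - {v})) = insert w \<sigma>" using that by auto
      ultimately show ?thesis by simp
    qed
    ultimately show ?thesis
      using False step.hyps by (intro collapsible.step[of "insert v \<tau>" w K]) auto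
  qed
qed

lemma finite_complex_restrict:
  assumes "finite_complex K" and "\<And>\<sigma> \<rho>. \<sigma> \<in> L \<Longrightarrow> \<rho> \<subseteq> \<sigma> \<Longrightarrow> \<rho> \<in> K \<Longrightarrow> \<rho> \<in> L" and "L \<subseteq> K"
  shows "finite_complex L"
  using assms unfolding finite_complex_def
  by (meson Union_mono finite_subset subsetD)

text \<open>\<open>{} \<in> K\<close> rules out the empty family. The empty simplex survives every
  step because \<open>\<tau>\<close> is nonempty, and in a cone it yields the vertex
  \<open>w\<close>, to which the straight-line homotopy contracts.\<close>

lemma collapsible_imp_contractible:
  assumes "collapsible K" and "finite_complex K" and "{} \<in> K"
  shows "contractible_space (geometric_realization K) \<and> topspace (geometric_realization K) \<noteq> {}"
  using assms
proof (induction K rule: collapsible.induct)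
  case (cone K w)
  define V where "V = \<Union>K"
  have V: "finite V" "\<Union>K \<subseteq> V" using cone finite_complexD(1) by (auto simp: V_def)
  have wV: "w \<in> V" using cone by (auto simp: V_def)
  define e :: "'a \<Rightarrow> real" where "e v = (if v = w then 1 else 0)" for v
  define h where "h = (\<lambda>(t::real, x) v. (1 - t) * x v + t * e v)"
  have e: "sum e V = 1" using V wV by (simp add: e_def)
  have h_in: "h (t, x) \<in> topspace (geometric_realization K)"
    if x: "x \<in> topspace (geometric_realization K)" and t: "0 \<le> t" "t \<le> 1" for t x
  proof -
    have "{v. h (t, x) v \<noteq> 0} \<subseteq> insert w {v. x v \<noteq> 0}" by (auto simp: h_def e_def)
    then have "{v. h (t, x) v \<noteq> 0} \<in> K"
      using finite_complexD(2) cone realizationD(2)[OF x] by blast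
    moreover have "0 \<le> h (t, x) v" for v
      using realizationD(1)[OF x] t by (auto simp: h_def e_def)
    moreover have "sum (h (t, x)) V = 1"
      using x in_realization_iff[OF V] e by (simp add: h_def sum.distrib flip: sum_distrib_left)
    ultimately show ?thesis using in_realization_iff[OF V] by blast
  qed
  have ch: "continuous_map (prod_topology (top_of_set {0..1}) (geometric_realization K))
      (geometric_realization K) h"
    unfolding continuous_map_into_realization
  proof (intro conjI allI funcsetI)
    fix v
    have "continuous_map (prod_topology (top_of_set {0..1}) (geometric_realization K)) euclideanreal
        (\<lambda>z. (1 - fst z) * snd z v + fst z * e v)"
      by (intro continuous_intros continuous_map_prod_realization_coordinate
          continuous_map_prod_interval_fst)
    then show "continuous_map (prod_topology (top_of_set {0..1}) (geometric_realization K))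
        euclideanreal (\<lambda>z. h z v)"
      by (simp add: h_def case_prod_beta)
  qed (auto intro: h_in)
  have "homotopic_with (\<lambda>x. True) (geometric_realization K) (geometric_realization K) id (\<lambda>x. e)"
    unfolding homotopic_with_def
    by (intro exI[of _ h] conjI) (use ch in \<open>auto simp: h_def\<close>)
  moreover have "e \<in> topspace (geometric_realization K)"
    using in_realization_iff[OF V, of e] e cone.prems cone.hyps by (auto simp: e_def)
  ultimately show ?case unfolding contractible_space_def by blast
next
  case (step \<tau> w K)
  let ?K' = "{\<sigma> \<in> K. \<not> \<tau> \<subseteq> \<sigma>}"
  have K': "finite_complex ?K'"
    using step.prems by (rule_tac finite_complex_restrict[of K]) auto
  have "geometric_realization K homotopy_equivalent_space geometric_realization ?K'"
    using step by (intro collapse_deformation) auto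
  moreover have "contractible_space (geometric_realization ?K')" "topspace (geometric_realization ?K') \<noteq> {}"
    using step K' by auto
  moreover have "topspace (geometric_realization ?K') \<subseteq> topspace (geometric_realization K)"
    by (auto simp: geometric_realization_def)
  ultimately show ?case
    using homotopy_equivalent_space_contractibility by blast
qed

section \<open>Wedges of spheres\<close>

lemma continuous_map_from_sum_topology:
  assumes "\<And>i. i \<in> I \<Longrightarrow> continuous_map (X i) Z (\<lambda>x. f (i, x))"
  shows "continuous_map (sum_topology X I) Z f"
  unfolding continuous_map_def
proof (intro conjI allI impI)
  show "f \<in> topspace (sum_topology X I) \<rightarrow> topspace Z"
    using assms unfolding continuous_map_def by fastforce
  fix U assume U: "openin Z U"
  have "openin (X i) {x. (i, x) \<in> {z \<in> topspace (sum_topology X I). f z \<in> U}}" if "i \<in> I" for i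
  proof -
    have "{x. (i, x) \<in> {z \<in> topspace (sum_topology X I). f z \<in> U}} =
        {x \<in> topspace (X i). f (i, x) \<in> U}"
      using that by auto
    then show ?thesis
      using openin_continuous_map_preimage[OF assms[OF that] U] by simp
  qed
  then show "openin (sum_topology X I) {z \<in> topspace (sum_topology X I). f z \<in> U}"
    unfolding openin_sum_topology by auto
qed

lemma Hausdorff_space_separating_maps:
  assumes "\<And>x y. x \<in> topspace X \<Longrightarrow> y \<in> topspace X \<Longrightarrow> x \<noteq> y \<Longrightarrow>
     \<exists>f. continuous_map X Y f \<and> f x \<noteq> f y" and Y: "Hausdorff_space Y"
  shows "Hausdorff_space X"
  unfolding Hausdorff_space_def
proof (intro allI impI, elim conjE)
  fix x y assume xy: "x \<in> topspace X" "y \<in> topspace X" "x \<noteq> y"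
  then obtain f where f: "continuous_map X Y f" "f x \<noteq> f y" using assms(1) by blast
  have "f x \<in> topspace Y" "f y \<in> topspace Y"
    using xy f(1) by (auto simp: continuous_map_def)
  then obtain U V where UV: "openin Y U" "openin Y V" "f x \<in> U" "f y \<in> V" "disjnt U V"
    using Y f(2) unfolding Hausdorff_space_def by meson
  show "\<exists>U V. openin X U \<and> openin X V \<and> x \<in> U \<and> y \<in> V \<and> disjnt U V"
    using UV xy openin_continuous_map_preimage[OF f(1)]
    by (intro exI[of _ "{z \<in> topspace X. f z \<in> U}"] exI[of _ "{z \<in> topspace X. f z \<in> V}"])
       (auto simp: disjnt_iff)
qed

section \<open>Spheres as compact Hausdorff spaces\<close>

lemma continuous_map_into_nsphere:
  assumes "\<And>i. continuous_map X euclideanreal (\<lambda>z. f z i)"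
    and "\<And>z. z \<in> topspace X \<Longrightarrow> f z \<in> topspace (nsphere d)"
  shows "continuous_map X (nsphere d) f"
  using assms unfolding nsphere continuous_map_in_subtopology continuous_map_componentwise_UNIV
  by auto

lemma Hausdorff_nsphere: "Hausdorff_space (nsphere d)"
  unfolding nsphere
  by (intro Hausdorff_space_subtopology) (auto simp: Hausdorff_space_product_topology)

lemma compact_nsphere: "compact_space (nsphere d)"
proof -
  let ?P = "powertop_real UNIV :: (nat \<Rightarrow> real) topology"
  let ?B = "PiE UNIV (\<lambda>v::nat. {-1..1::real})"
  have cB: "compactin ?P ?B"
    by (subst compactin_PiE) auto
  have cont: "continuous_map ?P euclideanreal (\<lambda>x. x v)" for v
    by (intro continuous_map_product_projection) auto
  have cl1: "closedin ?P (\<Inter>v\<in>{d<..}. {x. x v = 0})"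
    using closedin_continuous_map_preimage[OF cont, of "{0}"]
    by (intro closedin_INT) auto
  have cl2: "closedin ?P {x. (\<Sum>i\<le>d. x i ^ 2) = 1}"
  proof -
    have "continuous_map ?P euclideanreal (\<lambda>x. \<Sum>i\<le>d. x i ^ 2)"
      using cont by (intro continuous_map_sum continuous_map_real_pow) auto
    from closedin_continuous_map_preimage[OF this, of "{1}"] show ?thesis by simp
  qed
  have "topspace (nsphere d) = ?B \<inter> ({x. (\<Sum>i\<le>d. x i ^ 2) = 1} \<inter> (\<Inter>v\<in>{d<..}. {x. x v = 0}))"
    (is "?L = ?R")
  proof (intro equalityI subsetI)
    fix x assume "x \<in> ?L"
    then have x: "(\<Sum>i\<le>d. x i ^ 2) = 1" "\<forall>i>d. x i = 0" by (auto simp: nsphere)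
    have "-1 \<le> x i \<and> x i \<le> 1" for i
    proof (cases "i \<le> d")
      case True
      then have "x i ^ 2 \<le> (\<Sum>i\<le>d. x i ^ 2)" by (intro member_le_sum) auto
      then have "\<bar>x i\<bar> \<le> 1" using x by (simp add: abs_square_le_1)
      then show ?thesis by linarith
    qed (use x in auto)
    then show "x \<in> ?R" using x by auto
  qed (auto simp: nsphere)
  then have "compactin ?P (topspace (nsphere d))"
    using compact_Int_closedin[OF cB closedin_Int[OF cl2 cl1]] by simp
  moreover have "nsphere d = subtopology ?P (topspace (nsphere d))"
    by (simp add: nsphere)
  ultimately show ?thesis
    by (metis compact_space_subtopology)
qed

section \<open>The wedge as a quotient of a disjoint union of spheres\<close>

abbreviation sphere_inclusion :: "nat \<Rightarrow> (nat \<Rightarrow> real) \<Rightarrow> (nat \<times> (nat \<Rightarrow> real)) option" where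
  "sphere_inclusion i s \<equiv> wedge_proj (\<lambda>_. nsphere_basepoint) (i, s)"

lemma quotient_map_wedge_of_spheres:
  assumes "0 < k"
  shows "quotient_map (sum_topology (\<lambda>_. nsphere d) {..<k}) (wedge_of_spheres k d)
    (wedge_proj (\<lambda>_. nsphere_basepoint))"
  unfolding wedge_of_spheres_def
  using assms nsphere_basepoint_in by (intro quotient_map_wedge_proj[of 0]) auto

lemma continuous_map_sphere_inclusion:
  assumes "i < k"
  shows "continuous_map (nsphere d) (wedge_of_spheres k d) (sphere_inclusion i)"
proof -
  have "continuous_map (nsphere d) (sum_topology (\<lambda>_. nsphere d) {..<k}) (\<lambda>s. (i, s))"
    using assms by (intro continuous_map_component_injection[where X = "\<lambda>_. nsphere d"]) simp
  then have "continuous_map (nsphere d) (wedge_of_spheres k d)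
      (wedge_proj (\<lambda>_. nsphere_basepoint) \<circ> (\<lambda>s. (i, s)))"
    using quotient_imp_continuous_map[OF quotient_map_wedge_of_spheres[of k d]] assms
    by (intro continuous_map_compose) auto
  then show ?thesis by (simp add: o_def)
qed

lemma topspace_wedge_of_spheres:
  "topspace (wedge_of_spheres k d) =
    insert None (\<Union>i<k. sphere_inclusion i ` topspace (nsphere d))"
  unfolding wedge_of_spheres_def topspace_wedge_sum by auto

lemma sphere_inclusion_eq_iff:
  "sphere_inclusion i s = sphere_inclusion j t \<longleftrightarrow>
    s = nsphere_basepoint \<and> t = nsphere_basepoint \<or> i = j \<and> s = t"
  by (auto simp: wedge_proj_def)

lemma sphere_inclusion_eq_None_iff: "sphere_inclusion i s = None \<longleftrightarrow> s = nsphere_basepoint"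
  by (auto simp: wedge_proj_def)

text \<open>The map \<open>r i\<close> keeps the sphere with index \<open>i\<close> and sends all
  others to the basepoint; together these maps separate points.\<close>

lemma Hausdorff_wedge_of_spheres:
  assumes "0 < k"
  shows "Hausdorff_space (wedge_of_spheres k d)"
proof (rule Hausdorff_space_separating_maps[OF _ Hausdorff_nsphere[of d]])
  let ?W = "wedge_of_spheres k d"
  define r where "r i w = (case w of None \<Rightarrow> nsphere_basepoint
      | Some (j, s) \<Rightarrow> if j = i then s else nsphere_basepoint)"
    for i and w :: "(nat \<times> (nat \<Rightarrow> real)) option"
  have r_incl: "r i (sphere_inclusion j s) = (if j = i then s else nsphere_basepoint)" for i j s
    by (auto simp: r_def wedge_proj_def)
  have cont_r: "continuous_map ?W (nsphere d) (r i)" for i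
  proof (rule continuous_compose_quotient_map[OF quotient_map_wedge_of_spheres[OF assms]])
    show "continuous_map (sum_topology (\<lambda>_. nsphere d) {..<k}) (nsphere d)
        (r i \<circ> wedge_proj (\<lambda>_. nsphere_basepoint))"
    proof (rule continuous_map_from_sum_topology)
      fix j
      show "continuous_map (nsphere d) (nsphere d)
          (\<lambda>s. (r i \<circ> wedge_proj (\<lambda>_. nsphere_basepoint)) (j, s))"
        by (cases "j = i") (simp_all add: r_incl nsphere_basepoint_in)
    qed
  qed
  fix x y assume xy: "x \<in> topspace ?W" "y \<in> topspace ?W" "x \<noteq> y"
  have cases: "w = None \<or> (\<exists>i s. w = Some (i, s) \<and> s \<noteq> nsphere_basepoint)"
    if "w \<in> topspace ?W" for w
    using that by (auto simp: topspace_wedge_of_spheres wedge_proj_def split: if_splits)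
  have "\<exists>i. r i x \<noteq> r i y"
    using cases[OF xy(1)] cases[OF xy(2)] xy(3)
    by (auto simp: r_def split: if_splits)
  then show "\<exists>f. continuous_map ?W (nsphere d) f \<and> f x \<noteq> f y"
    using cont_r by blast
qed

lemma wedge_of_one_sphere: "wedge_of_spheres 1 d homeomorphic_space nsphere d"
proof -
  have "homeomorphic_map (nsphere d) (wedge_of_spheres 1 d) (sphere_inclusion 0)"
  proof (rule T1_Spaces.continuous_imp_homeomorphic_map)
    show "sphere_inclusion 0 ` topspace (nsphere d) = topspace (wedge_of_spheres 1 d)"
      using nsphere_basepoint_in[of d] sphere_inclusion_eq_None_iff[of 0 nsphere_basepoint]
      by (auto simp: topspace_wedge_of_spheres) (metis imageI)
    show "inj_on (sphere_inclusion 0) (topspace (nsphere d))"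
      by (auto simp: inj_on_def sphere_inclusion_eq_iff)
  qed (use continuous_map_sphere_inclusion Hausdorff_wedge_of_spheres compact_nsphere in auto)
  then show ?thesis
    using homeomorphic_map_imp_homeomorphic_space homeomorphic_space_sym by blast
qed

section \<open>Collapsing the boundary of a simplex\<close>

text \<open>The map is inverse stereographic projection applied to the point \<open>w / m\<close> of \<open>\<real>\<^sup>d\<close>,
  where \<open>w\<^sub>i = y\<^sub>i - y\<^sub>0\<close> and \<open>m\<close> is the least barycentric coordinate of \<open>y\<close>; multiplying out \<open>m\<close>
  extends it to the boundary \<open>m = 0\<close>.\<close>

definition simplex_to_sphere :: "nat \<Rightarrow> (nat \<Rightarrow> real) \<Rightarrow> nat \<Rightarrow> real" where
  "simplex_to_sphere d y =
    (let m = Min (y ` {..d}); q = (\<Sum>i=1..d. (y i - y 0)\<^sup>2)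
     in (\<lambda>i. if i = 0 then (q - m\<^sup>2) / (q + m\<^sup>2)
             else if i \<le> d then 2 * m * (y i - y 0) / (q + m\<^sup>2) else 0))"

definition barycentric :: "nat \<Rightarrow> (nat \<Rightarrow> real) \<Rightarrow> bool" where
  "barycentric d y \<longleftrightarrow> (\<forall>i\<le>d. 0 \<le> y i) \<and> sum y {..d} = 1"

lemma sum_atMost_split_first: "sum f {..d} = f 0 + sum f {1..d}" for f :: "nat \<Rightarrow> 'a :: comm_monoid_add"
  by (simp add: atMost_atLeast0 sum.atLeast_Suc_atMost)

text \<open>If the denominator vanished, all coordinates would equal their minimum and this would be
  0, against total mass 1.\<close>

lemma simplex_to_sphere_denominator_pos:
  assumes "barycentric d y"
  shows "0 < (\<Sum>i=1..d. (y i - y 0)\<^sup>2) + (Min (y ` {..d}))\<^sup>2"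
proof (rule ccontr)
  assume "\<not> ?thesis"
  moreover have "0 \<le> (\<Sum>i=1..d. (y i - y 0)\<^sup>2)" by (intro sum_nonneg) auto
  ultimately have z: "(\<Sum>i=1..d. (y i - y 0)\<^sup>2) = 0" "(Min (y ` {..d}))\<^sup>2 = 0"
    using zero_le_power2[of "Min (y ` {..d})"] by linarith+
  have eq: "y i = y 0" if "i \<le> d" for i
    using z(1) that by (cases "i = 0") (auto simp: sum_nonneg_eq_0_iff)
  have "y ` {..d} = (\<lambda>_. y 0) ` {..d}" by (intro image_cong refl eq) simp
  then have "y 0 = 0" using z(2) by (simp add: image_constant_conv)
  moreover have "sum y {..d} = (\<Sum>i\<le>d. y 0)" by (intro sum.cong refl eq) simp
  ultimately show False using assms by (simp add: barycentric_def)
qed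

lemma simplex_to_sphere_in:
  assumes "barycentric d y"
  shows "simplex_to_sphere d y \<in> topspace (nsphere d)"
proof -
  define m where "m = Min (y ` {..d})"
  define q where "q = (\<Sum>i=1..d. (y i - y 0)\<^sup>2)"
  have pos: "0 < q + m\<^sup>2"
    using simplex_to_sphere_denominator_pos[OF assms] by (simp add: m_def q_def)
  have "(\<Sum>i\<le>d. (simplex_to_sphere d y i)\<^sup>2) =
      ((q - m\<^sup>2) / (q + m\<^sup>2))\<^sup>2 + (\<Sum>i=1..d. (2 * m / (q + m\<^sup>2))\<^sup>2 * (y i - y 0)\<^sup>2)"
    unfolding sum_atMost_split_first
    by (intro arg_cong2[where f = "(+)"] sum.cong)
       (auto simp: simplex_to_sphere_def Let_def m_def q_def power_mult_distrib power_divide)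
  also have "\<dots> = ((q - m\<^sup>2) / (q + m\<^sup>2))\<^sup>2 + (2 * m / (q + m\<^sup>2))\<^sup>2 * q"
    by (simp add: q_def sum_distrib_left)
  also have "\<dots> = ((q - m\<^sup>2)\<^sup>2 + (2 * m)\<^sup>2 * q) / (q + m\<^sup>2)\<^sup>2"
    by (simp add: power_divide add_divide_distrib)
  also have "(q - m\<^sup>2)\<^sup>2 + (2 * m)\<^sup>2 * q = (q + m\<^sup>2)\<^sup>2"
    by (simp add: power2_eq_square algebra_simps)
  finally have "(\<Sum>i\<le>d. (simplex_to_sphere d y i)\<^sup>2) = 1" using pos by simp
  then show ?thesis
    by (simp add: nsphere) (auto simp: simplex_to_sphere_def Let_def)
qed

text \<open>The basepoint is the pole of the stereographic projection, so the boundary of the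
  simplex, and nothing else, is crushed to it.\<close>

lemma simplex_to_sphere_eq_basepoint_iff:
  assumes "barycentric d y"
  shows "simplex_to_sphere d y = nsphere_basepoint \<longleftrightarrow> Min (y ` {..d}) = 0"
proof -
  define m where "m = Min (y ` {..d})"
  define q where "q = (\<Sum>i=1..d. (y i - y 0)\<^sup>2)"
  have pos: "0 < q + m\<^sup>2"
    using simplex_to_sphere_denominator_pos[OF assms] by (simp add: m_def q_def)
  have s0: "simplex_to_sphere d y 0 = (q - m\<^sup>2) / (q + m\<^sup>2)"
    by (simp add: simplex_to_sphere_def Let_def m_def q_def)
  have "m = 0" if "simplex_to_sphere d y = nsphere_basepoint"
  proof -
    have "(q - m\<^sup>2) / (q + m\<^sup>2) = 1" unfolding s0[symmetric] that by (simp add: nsphere_basepoint_def)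
    then have "q - m\<^sup>2 = q + m\<^sup>2" using pos by (simp only: divide_eq_1_iff)
    then show ?thesis by simp
  qed
  moreover have "simplex_to_sphere d y = nsphere_basepoint" if "m = 0"
    using that pos by (auto simp: simplex_to_sphere_def nsphere_basepoint_def Let_def m_def q_def)
  ultimately show ?thesis by (auto simp: m_def)
qed

text \<open>Stereographic projection recovers the quotients \<open>(y i - y 0) / m\<close>, which
  determine \<open>y\<close> up to a scale and a constant shift. Comparing minima excludes the
  shift, and the total mass fixes the scale.\<close>

lemma simplex_to_sphere_inj:
  assumes y: "barycentric d y" "0 < Min (y ` {..d})"
    and z: "barycentric d z" "0 < Min (z ` {..d})"
    and eq: "simplex_to_sphere d y = simplex_to_sphere d z" and "j \<le> d"
  shows "y j = z j"
proof -
  have key: "(y i - y 0) / Min (y ` {..d}) =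
      simplex_to_sphere d y i / (1 - simplex_to_sphere d y 0)"
    if y: "barycentric d y" "0 < Min (y ` {..d})" and i: "1 \<le> i" "i \<le> d" for y i
  proof -
    define m where "m = Min (y ` {..d})"
    define q where "q = (\<Sum>i=1..d. (y i - y 0)\<^sup>2)"
    have pos: "0 < q + m\<^sup>2" "0 < m"
      using simplex_to_sphere_denominator_pos[OF y(1)] y(2) by (simp_all add: m_def q_def)
    have "1 - simplex_to_sphere d y 0 = 2 * m\<^sup>2 / (q + m\<^sup>2)"
    proof -
      have "simplex_to_sphere d y 0 = (q - m\<^sup>2) / (q + m\<^sup>2)"
        by (simp add: simplex_to_sphere_def Let_def m_def q_def)
      then have "1 - simplex_to_sphere d y 0 = ((q + m\<^sup>2) - (q - m\<^sup>2)) / (q + m\<^sup>2)"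
        using pos by (simp only: diff_divide_distrib[of "q + m\<^sup>2"] divide_self_if) simp
      then show ?thesis by simp
    qed
    moreover have "simplex_to_sphere d y i = 2 * m * (y i - y 0) / (q + m\<^sup>2)"
      using i by (simp add: simplex_to_sphere_def Let_def m_def q_def)
    ultimately show ?thesis
      using pos by (simp add: power2_eq_square flip: m_def)
  qed
  define m where "m = Min (y ` {..d})"
  define n where "n = Min (z ` {..d})"
  have mn: "0 < m" "0 < n" using y z by (simp_all add: m_def n_def)
  define c where "c = z 0 - n / m * y 0"
  have zi: "z i = n / m * y i + c" if "i \<le> d" for i
  proof (cases "i = 0")
    case False
    then have "(y i - y 0) / m = (z i - z 0) / n"
      using key[OF y, of i] key[OF z, of i] that eq by (simp add: m_def n_def)
    then show ?thesis using mn by (simp add: c_def field_simps)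
  qed (simp add: c_def)
  \<comment> \<open>\<open>a\<close> and \<open>b\<close> attain the two minima. Comparing
    \<open>n\<close> with \<open>z a\<close> gives \<open>0 \<le> c\<close>, and comparing
    \<open>m\<close> with \<open>y b\<close> gives \<open>c \<le> 0\<close>.\<close>
  have "m \<in> y ` {..d}" "n \<in> z ` {..d}" unfolding m_def n_def by (intro Min_in; simp)+
  then obtain a b where ab: "a \<le> d" "m = y a" "b \<le> d" "n = z b" by auto
  have "n \<le> z a" unfolding n_def using ab(1) by (intro Min_le) auto
  also have "z a = n + c" using zi[of a] ab mn by simp
  finally have "0 \<le> c" by simp
  moreover have "m \<le> y b" unfolding m_def using ab(3) by (intro Min_le) auto
  then have "n / m * m \<le> n / m * y b" using mn by (intro mult_left_mono) simp_all
  then have "n \<le> z b - c" unfolding zi[OF ab(3)] using mn by simp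
  then have "c \<le> 0" unfolding ab(4)[symmetric] by simp
  ultimately have c: "c = 0" by simp
  have "sum z {..d} = n / m * sum y {..d}"
    unfolding sum_distrib_left using zi c by (intro sum.cong) auto
  then have "n / m = 1" using y z by (simp add: barycentric_def)
  then show ?thesis using zi[OF \<open>j \<le> d\<close>] c by simp
qed

lemma simplex_to_sphere_surj:
  assumes s: "s \<in> topspace (nsphere d)" "s \<noteq> nsphere_basepoint"
  obtains y where "barycentric d y" "0 < Min (y ` {..d})" "simplex_to_sphere d y = s"
proof -
  have ss: "(s 0)\<^sup>2 + (\<Sum>i=1..d. (s i)\<^sup>2) = 1" and s_out: "\<And>i. d < i \<Longrightarrow> s i = 0"
    using s(1) unfolding nsphere by (auto simp: sum_atMost_split_first)
  have "s 0 \<noteq> 1"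
  proof
    assume "s 0 = 1"
    then have "(\<Sum>i=1..d. (s i)\<^sup>2) = 0" using ss by simp
    then have "s i = 0" if "1 \<le> i" "i \<le> d" for i using that by (auto simp: sum_nonneg_eq_0_iff)
    then have "s i = nsphere_basepoint i" for i
      using s_out[of i] \<open>s 0 = 1\<close> by (cases "i = 0"; cases "i \<le> d") (auto simp: nsphere_basepoint_def)
    then show False using s(2) by blast
  qed
  \<comment> \<open>\<open>v\<close> is the stereographic image of \<open>s\<close>, extended by
    \<open>v 0 = 0\<close>. Shifting it to have minimum 1 and dividing by the total \<open>U\<close>
    gives a \<open>y\<close> with minimum \<open>1 / U\<close>, so that
    \<open>(y i - y 0) / m\<close> is \<open>v i\<close> again.\<close>
  define v where "v i = (if i = 0 then 0 else s i / (1 - s 0))" for i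
  define u where "u i = 1 - Min (v ` {..d}) + v i" for i
  have "Min (v ` {..d}) \<in> v ` {..d}" by (intro Min_in) auto
  then obtain a where a: "a \<le> d" "Min (v ` {..d}) = v a" by (metis atMost_iff imageE)
  have u1: "1 \<le> u i" if "i \<le> d" for i
  proof -
    have "Min (v ` {..d}) \<le> v i" using that by (intro Min_le) auto
    then show ?thesis unfolding u_def by linarith
  qed
  have "u a = 1" using a by (simp add: u_def)
  define U where "U = sum u {..d}"
  have U: "0 < U" unfolding U_def using u1 by (intro sum_pos) (auto intro: less_le_trans[OF zero_less_one])
  define y where "y i = u i / U" for i
  have m: "Min (y ` {..d}) = 1 / U"
  proof (rule Min_eqI)
    show "1 / U \<in> y ` {..d}" using a \<open>u a = 1\<close> by (intro image_eqI[of _ _ a]) (auto simp: y_def)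
  next
    fix t assume "t \<in> y ` {..d}"
    then show "1 / U \<le> t" using u1 U by (auto simp: y_def divide_right_mono)
  qed simp
  have bary: "barycentric d y"
    using U u1 by (auto simp: barycentric_def y_def U_def simp flip: sum_divide_distrib
      intro!: divide_nonneg_pos intro: order_trans[OF zero_le_one])
  have w: "y i - y 0 = v i / U" for i by (simp add: y_def u_def v_def flip: diff_divide_distrib)
  have "(\<Sum>i=1..d. (v i)\<^sup>2) = (\<Sum>i=1..d. (s i)\<^sup>2) / (1 - s 0)\<^sup>2"
    unfolding sum_divide_distrib by (intro sum.cong) (auto simp: v_def power_divide)
  also have "\<dots> = (1 + s 0) * (1 - s 0) / (1 - s 0)\<^sup>2"
    using ss by (simp add: power2_eq_square algebra_simps)
  also have "\<dots> = (1 + s 0) / (1 - s 0)" using \<open>s 0 \<noteq> 1\<close> by (simp add: power2_eq_square)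
  finally have sv: "(\<Sum>i=1..d. (v i)\<^sup>2) = (1 + s 0) / (1 - s 0)" .
  define q where "q = (\<Sum>i=1..d. (y i - y 0)\<^sup>2)"
  have q: "q = (1 + s 0) / (1 - s 0) * (1 / U)\<^sup>2"
    unfolding q_def w power_divide sv[symmetric] by (simp add: sum_divide_distrib)
  have qm: "q + (1 / U)\<^sup>2 = 2 / (1 - s 0) * (1 / U)\<^sup>2" "q - (1 / U)\<^sup>2 = 2 * s 0 / (1 - s 0) * (1 / U)\<^sup>2"
    using \<open>s 0 \<noteq> 1\<close> U unfolding q by (simp_all add: field_simps)
  have "simplex_to_sphere d y i = s i" for i
  proof -
    have "simplex_to_sphere d y i = (if i = 0 then (q - (1 / U)\<^sup>2) / (q + (1 / U)\<^sup>2)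
             else if i \<le> d then 2 * (1 / U) * (v i / U) / (q + (1 / U)\<^sup>2) else 0)"
      by (simp only: simplex_to_sphere_def Let_def m w q_def)
    also have "\<dots> = s i"
      unfolding qm using \<open>s 0 \<noteq> 1\<close> U s_out[of i]
      by (auto simp: v_def power2_eq_square)
    finally show ?thesis .
  qed
  then show ?thesis using that[OF bary] m U by auto
qed

lemma continuous_map_simplex_to_sphere:
  assumes cont: "\<And>i. i \<le> d \<Longrightarrow> continuous_map X euclideanreal (\<lambda>z. f z i)"
    and bary: "\<And>z. z \<in> topspace X \<Longrightarrow> barycentric d (f z)"
  shows "continuous_map X (nsphere d) (\<lambda>z. simplex_to_sphere d (f z))"
proof (rule continuous_map_into_nsphere)
  fix i
  have m: "continuous_map X euclideanreal (\<lambda>z. Min (f z ` {..d}))"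
    using cont by (intro continuous_map_Min) auto
  have q: "continuous_map X euclideanreal (\<lambda>z. \<Sum>i=1..d. (f z i - f z 0)\<^sup>2)"
    using cont by (intro continuous_map_sum continuous_map_real_pow continuous_map_diff) auto
  have nz: "(\<Sum>i=1..d. (f z i - f z 0)\<^sup>2) + (Min (f z ` {..d}))\<^sup>2 \<noteq> 0" if "z \<in> topspace X" for z
    using simplex_to_sphere_denominator_pos[OF bary[OF that]] by simp
  consider "i = 0" | "i \<noteq> 0" "i \<le> d" | "d < i" by linarith
  then show "continuous_map X euclideanreal (\<lambda>z. simplex_to_sphere d (f z) i)"
  proof cases
    case 1
    have "continuous_map X euclideanreal (\<lambda>z.
      ((\<Sum>i=1..d. (f z i - f z 0)\<^sup>2) - (Min (f z ` {..d}))\<^sup>2) /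
      ((\<Sum>i=1..d. (f z i - f z 0)\<^sup>2) + (Min (f z ` {..d}))\<^sup>2))"
      by (intro continuous_map_real_divide continuous_map_diff continuous_map_add
          continuous_map_real_pow m q nz)
    with 1 show ?thesis by (simp add: simplex_to_sphere_def Let_def)
  next
    case 2
    have "continuous_map X euclideanreal (\<lambda>z. 2 * Min (f z ` {..d}) * (f z i - f z 0) /
      ((\<Sum>i=1..d. (f z i - f z 0)\<^sup>2) + (Min (f z ` {..d}))\<^sup>2))"
      using cont 2 by (intro continuous_map_real_divide continuous_map_diff continuous_map_add
          continuous_map_real_pow continuous_map_real_mult continuous_map_const[THEN iffD2] m q nz) auto
    with 2 show ?thesis by (simp add: simplex_to_sphere_def Let_def)
  qed (simp add: simplex_to_sphere_def Let_def)
qed (simp add: bary simplex_to_sphere_in)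

section \<open>Contracting a subspace\<close>

text \<open>The classical equivalence of X and X / A when a contraction of A extends to X. The
  quotient is not formed: \<open>W\<close> is any Hausdorff space with a surjection \<open>q\<close>
  that identifies only points of \<open>A\<close>. As \<open>h\<close> keeps \<open>A\<close> inside
  \<open>A\<close> and ends constant on it, both \<open>h (1, x)\<close> and
  \<open>q (h (t, x))\<close> are constant on fibres; they descend to the inverse \<open>g\<close>
  and to the homotopy \<open>k\<close> from the identity to \<open>q \<circ> g\<close>.\<close>

lemma homotopy_equivalent_quotient:
  fixes X :: "'a topology" and W :: "'b topology" and h :: "real \<times> 'a \<Rightarrow> 'a"
  assumes X: "compact_space X" and W: "Hausdorff_space W"
    and A: "A \<subseteq> topspace X"
    and q: "continuous_map X W q" "q ` topspace X = topspace W"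
    and q_inj: "\<And>x y. x \<in> topspace X \<Longrightarrow> y \<in> topspace X \<Longrightarrow> q x = q y \<Longrightarrow> x = y \<or> x \<in> A \<and> y \<in> A"
    and q_A: "\<And>x y. x \<in> A \<Longrightarrow> y \<in> A \<Longrightarrow> q x = q y"
    and h: "continuous_map (prod_topology (top_of_set {0..1}) X) X h"
    and h0: "\<And>x. x \<in> topspace X \<Longrightarrow> h (0, x) = x"
    and h_A: "\<And>t x. 0 \<le> t \<Longrightarrow> t \<le> 1 \<Longrightarrow> x \<in> A \<Longrightarrow> h (t, x) \<in> A"
    and h1: "\<And>x. x \<in> A \<Longrightarrow> h (1, x) = a"
  shows "X homotopy_equivalent_space W"
proof -
  let ?I = "top_of_set {0..1::real}"
  have "quotient_map X W q"
    using q X W by (rule_tac T1_Spaces.continuous_imp_quotient_map) auto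
  moreover have "continuous_map X X (\<lambda>x. h (1, x))"
    using continuous_map_o_Pair[OF h, of 1] by (simp add: o_def)
  moreover have "h (1, x) = h (1, y)" if "x \<in> topspace X" "y \<in> topspace X" "q x = q y" for x y
    using q_inj[OF that] h1 by metis
  ultimately have "\<exists>g. continuous_map W X g \<and> (\<forall>x\<in>topspace X. g (q x) = h (1, x))"
  proof (rule quotient_map_lift_exists)
    fix g assume "continuous_map W X g" "\<And>x. x \<in> topspace X \<Longrightarrow> g (q x) = h (1, x)"
    then show ?thesis by (intro exI[of _ g]) simp
  qed
  then obtain g where g: "continuous_map W X g" "\<forall>x\<in>topspace X. g (q x) = h (1, x)"
    by blast
  let ?Q = "\<lambda>z. (fst z, q (snd z))"
  have "continuous_map (prod_topology ?I X) (prod_topology ?I W) (\<lambda>z. (fst z, (q \<circ> snd) z))"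
    by (intro continuous_map_paired[THEN iffD2] conjI continuous_map_fst
        continuous_map_compose[OF continuous_map_snd q(1)])
  then have Qc: "continuous_map (prod_topology ?I X) (prod_topology ?I W) ?Q"
    by (simp add: o_def)
  \<comment> \<open>After multiplying with the interval the source is still compact and the target
    Hausdorff, so \<open>?Q\<close> is a quotient map by the same criterion as
    \<open>q\<close>.\<close>
  have "compact_space (prod_topology ?I X)"
    using X by (auto simp: compact_space_prod_topology compact_space_subtopology)
  moreover have "Hausdorff_space (prod_topology ?I W)"
    using W by (auto simp: Hausdorff_space_prod_topology Hausdorff_space_subtopology)
  moreover have "?Q ` topspace (prod_topology ?I X) = topspace (prod_topology ?I W)"
    using q(2) by force
  ultimately have "quotient_map (prod_topology ?I X) (prod_topology ?I W) ?Q"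
    using Qc by (rule_tac T1_Spaces.continuous_imp_quotient_map) auto
  moreover have "continuous_map (prod_topology ?I X) W (q \<circ> h)"
    by (intro continuous_map_compose[OF h q(1)])
  moreover have "(q \<circ> h) y = (q \<circ> h) z"
    if y: "y \<in> topspace (prod_topology ?I X)" and z: "z \<in> topspace (prod_topology ?I X)"
      and eq: "?Q y = ?Q z" for y z
  proof -
    obtain t x x' where yz: "y = (t, x)" "z = (t, x')" "q x = q x'"
      using eq by (cases y; cases z) auto
    have "x = x' \<or> x \<in> A \<and> x' \<in> A" using yz y z by (intro q_inj) auto
    then show ?thesis using yz y h_A[of t x] h_A[of t x'] q_A by auto
  qed
  ultimately have "\<exists>k. continuous_map (prod_topology ?I W) W k \<and>
    (\<forall>z\<in>topspace (prod_topology ?I X). k (?Q z) = (q \<circ> h) z)"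
  proof (rule quotient_map_lift_exists)
    fix k assume "continuous_map (prod_topology ?I W) W k"
      "\<And>z. z \<in> topspace (prod_topology ?I X) \<Longrightarrow> k (?Q z) = (q \<circ> h) z"
    then show ?thesis by blast
  qed
  then obtain k where k: "continuous_map (prod_topology ?I W) W k"
    "\<forall>z\<in>topspace (prod_topology ?I X). k (?Q z) = (q \<circ> h) z"
    by blast
  have k': "k (t, q x) = q (h (t, x))" if "0 \<le> t" "t \<le> 1" "x \<in> topspace X" for t x
    using bspec[OF k(2), of "(t, x)"] that by simp
  show ?thesis
    unfolding homotopy_equivalent_space_def
  proof (intro exI conjI)
    have "homotopic_with (\<lambda>x. True) X X id (g \<circ> q)"
      by (subst homotopic_with) (use h h0 g(2) in auto)
    then show "homotopic_with (\<lambda>x. True) X X (g \<circ> q) id"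
      by (simp add: homotopic_with_sym)
    have "k (0, w) = w \<and> k (1, w) = q (g w)" if w: "w \<in> topspace W" for w
    proof -
      obtain x where "x \<in> topspace X" "w = q x" using w q(2) by blast
      then show ?thesis using k'[of 0 x] k'[of 1 x] h0 g(2) by simp
    qed
    then have "homotopic_with (\<lambda>x. True) W W id (q \<circ> g)"
      by (subst homotopic_with) (use k(1) in auto)
    then show "homotopic_with (\<lambda>x. True) W W (q \<circ> g) id"
      by (simp add: homotopic_with_sym)
  qed (use q g in auto)
qed

section \<open>Complexes with contractible complement of facets\<close>

text \<open>The functions \<open>e i\<close> enumerate the vertices of the removed facets, all of dimension \<open>d\<close>.\<close>

locale contractible_facet_complement =
  fixes K :: "'a set set" and d k :: nat and e :: "nat \<Rightarrow> nat \<Rightarrow> 'a"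
  assumes K: "finite_complex K" and k_pos: "0 < k"
    and inj_e: "i < k \<Longrightarrow> inj_on (e i) {..d}"
    and facet_in: "i < k \<Longrightarrow> e i ` {..d} \<in> K"
    and facet_eq: "i < k \<Longrightarrow> j < k \<Longrightarrow> e i ` {..d} = e j ` {..d} \<Longrightarrow> i = j"
    and facet_maximal: "i < k \<Longrightarrow> \<sigma> \<in> K \<Longrightarrow> e i ` {..d} \<subseteq> \<sigma> \<Longrightarrow> \<sigma> = e i ` {..d}"
    and contractible: "contractible_space (geometric_realization (K - (\<lambda>i. e i ` {..d}) ` {..<k}))"
    and nonempty: "topspace (geometric_realization (K - (\<lambda>i. e i ` {..d}) ` {..<k})) \<noteq> {}"
begin

abbreviation facet :: "nat \<Rightarrow> 'a set" where "facet i \<equiv> e i ` {..d}"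

abbreviation X :: "('a \<Rightarrow> real) topology" where "X \<equiv> geometric_realization K"

definition D :: "'a set set" where "D = K - (\<lambda>i. facet i) ` {..<k}"

abbreviation A :: "('a \<Rightarrow> real) set" where "A \<equiv> topspace (geometric_realization D)"

abbreviation min_coord :: "nat \<Rightarrow> ('a \<Rightarrow> real) \<Rightarrow> real" where
  "min_coord i x \<equiv> Min ((\<lambda>j. x (e i j)) ` {..d})"

section \<open>The least coordinate on each removed facet\<close>

lemma finite_vertices: "finite (\<Union>K)"
  using K by (rule finite_complexD)

lemma in_X_iff: "x \<in> topspace X \<longleftrightarrow> (\<forall>v. 0 \<le> x v) \<and> {v. x v \<noteq> 0} \<in> K \<and> sum x (\<Union>K) = 1"
  by (rule in_realization_iff[OF finite_vertices order_refl])

lemma in_A_iff: "x \<in> A \<longleftrightarrow> x \<in> topspace X \<and> (\<forall>i<k. {v. x v \<noteq> 0} \<noteq> facet i)"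
proof -
  have "\<Union>D \<subseteq> \<Union>K" by (auto simp: D_def)
  from in_realization_iff[OF finite_vertices this] show ?thesis
    unfolding in_X_iff by (auto simp: D_def)
qed

lemma min_coord_nonneg: "x \<in> topspace X \<Longrightarrow> 0 \<le> min_coord i x"
  by (auto simp: in_X_iff)

text \<open>A support that contains \<open>facet i\<close> cannot be larger, by maximality. Hence at
  most one \<open>min_coord i\<close> is positive at a given point.\<close>

lemma min_coord_pos_iff:
  assumes "x \<in> topspace X" and "i < k"
  shows "0 < min_coord i x \<longleftrightarrow> {v. x v \<noteq> 0} = facet i"
proof -
  have "0 < min_coord i x \<longleftrightarrow> (\<forall>j\<le>d. 0 < x (e i j))" by auto
  also have "\<dots> \<longleftrightarrow> (\<forall>j\<le>d. x (e i j) \<noteq> 0)"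
    using assms(1) by (auto simp: in_X_iff less_le)
  also have "\<dots> \<longleftrightarrow> facet i \<subseteq> {v. x v \<noteq> 0}" by auto
  also have "\<dots> \<longleftrightarrow> {v. x v \<noteq> 0} = facet i"
    using facet_maximal[OF assms(2), of "{v. x v \<noteq> 0}"] assms(1) by (auto simp: in_X_iff)
  finally show ?thesis .
qed

lemma min_coord_eq_0:
  assumes "x \<in> topspace X" "i < k" "{v. x v \<noteq> 0} \<noteq> facet i"
  shows "min_coord i x = 0"
  using min_coord_pos_iff[OF assms(1,2)] min_coord_nonneg[OF assms(1), of i] assms(3) by linarith

text \<open>Lets sums over all facets replace a case distinction on the facet containing
  \<open>x\<close>, so that \<open>pushed\<close> and \<open>remaining\<close> are given by visibly
  continuous formulas.\<close>

lemma sum_min_coord: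
  assumes "x \<in> topspace X" "i < k" "{v. x v \<noteq> 0} = facet i" "\<And>j. f j 0 = (0::real)"
  shows "(\<Sum>j<k. f j (min_coord j x)) = f i (min_coord i x)"
proof -
  have "f j (min_coord j x) = 0" if "j < k" "j \<noteq> i" for j
  proof -
    have "{v. x v \<noteq> 0} \<noteq> facet j" using assms that facet_eq[of i j] by metis
    then show ?thesis using min_coord_eq_0[OF assms(1) that(1)] assms(4) by simp
  qed
  then have "(\<Sum>j<k. f j (min_coord j x)) = (\<Sum>j\<in>{i}. f j (min_coord j x))"
    using assms(2) by (intro sum.mono_neutral_right) auto
  then show ?thesis by simp
qed

lemma barycentric_facet:
  assumes "x \<in> topspace X" "i < k" "{v. x v \<noteq> 0} \<subseteq> facet i"
  shows "barycentric d (\<lambda>j. x (e i j))"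
proof -
  have "sum x (facet i) = sum x (\<Union>K)"
    using assms facet_in[OF assms(2)] finite_vertices by (intro sum.mono_neutral_left) auto
  then show ?thesis
    using assms(1) inj_e[OF assms(2)] by (simp add: barycentric_def in_X_iff sum.reindex)
qed

lemma continuous_map_min_coord: "continuous_map X euclideanreal (min_coord i)"
  by (rule continuous_map_Min[of "{..d}" X "\<lambda>x j. x (e i j)"])
     (auto intro: continuous_map_realization_coordinate)

lemma continuous_map_prod_min_coord:
  "continuous_map (prod_topology T X) euclideanreal (\<lambda>z. min_coord i (snd z))"
  using continuous_map_compose[OF continuous_map_snd continuous_map_min_coord]
  by (simp add: o_def)

section \<open>The quotient map onto the wedge\<close>

definition collapse :: "('a \<Rightarrow> real) \<Rightarrow> (nat \<times> (nat \<Rightarrow> real)) option" where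
  "collapse x = (if \<exists>i<k. {v. x v \<noteq> 0} = facet i
     then sphere_inclusion (THE i. i < k \<and> {v. x v \<noteq> 0} = facet i)
       (simplex_to_sphere d (\<lambda>j. x (e (THE i. i < k \<and> {v. x v \<noteq> 0} = facet i) j)))
     else None)"

text \<open>On the boundary of a facet the right-hand side is the basepoint, hence
  \<open>None\<close>. One formula on the whole closed facet is what allows continuity to be shown
  by pasting.\<close>

lemma collapse_facet:
  assumes x: "x \<in> topspace X" and i: "i < k" and sub: "{v. x v \<noteq> 0} \<subseteq> facet i"
  shows "collapse x = sphere_inclusion i (simplex_to_sphere d (\<lambda>j. x (e i j)))"
proof (cases "{v. x v \<noteq> 0} = facet i")
  case True
  then have "(THE i. i < k \<and> {v. x v \<noteq> 0} = facet i) = i"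
    using i facet_eq by (intro the_equality) auto
  then show ?thesis using True i by (auto simp: collapse_def)
next
  case False
  have "\<not> (\<exists>j<k. {v. x v \<noteq> 0} = facet j)"
    using False sub facet_maximal facet_in[OF i] by metis
  then have "collapse x = None" unfolding collapse_def by (rule if_not_P)
  moreover have "simplex_to_sphere d (\<lambda>j. x (e i j)) = nsphere_basepoint"
    using simplex_to_sphere_eq_basepoint_iff[OF barycentric_facet[OF x i sub]]
      min_coord_eq_0[OF x i False] by simp
  ultimately show ?thesis by (simp add: wedge_proj_def)
qed

lemma collapse_A: "x \<in> A \<Longrightarrow> collapse x = None"
  unfolding in_A_iff collapse_def by (intro if_not_P) blast

lemma not_A_cases:
  assumes "x \<in> topspace X" "x \<notin> A"
  obtains i where "i < k" "{v. x v \<noteq> 0} = facet i"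
  using assms in_A_iff by blast

lemma collapse_inj:
  assumes x: "x \<in> topspace X" and y: "y \<in> topspace X" and eq: "collapse x = collapse y"
  shows "x = y \<or> x \<in> A \<and> y \<in> A"
proof -
  have notin: "\<exists>i<k. {v. x v \<noteq> 0} = facet i \<and> 0 < min_coord i x
      \<and> barycentric d (\<lambda>j. x (e i j)) \<and> simplex_to_sphere d (\<lambda>j. x (e i j)) \<noteq> nsphere_basepoint
      \<and> collapse x = sphere_inclusion i (simplex_to_sphere d (\<lambda>j. x (e i j)))"
    if x: "x \<in> topspace X" "x \<notin> A" for x
  proof -
    obtain i where i: "i < k" "{v. x v \<noteq> 0} = facet i" using not_A_cases[OF x] .
    have b: "barycentric d (\<lambda>j. x (e i j))" using barycentric_facet[OF x(1) i(1)] i(2) by simp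
    have m: "0 < min_coord i x" using min_coord_pos_iff[OF x(1) i(1)] i(2) by blast
    have "simplex_to_sphere d (\<lambda>j. x (e i j)) \<noteq> nsphere_basepoint"
      using simplex_to_sphere_eq_basepoint_iff[OF b] m by linarith
    then show ?thesis
      using i b m collapse_facet[OF x(1) i(1) equalityD1[OF i(2)]] by blast
  qed
  have ne: "collapse x \<noteq> None" if "x \<in> topspace X" "x \<notin> A" for x
    using notin[OF that] sphere_inclusion_eq_None_iff by metis
  show ?thesis
  proof (cases "x \<in> A \<or> y \<in> A")
    case True
    then show ?thesis using ne x y eq collapse_A by metis
  next
    case False
    obtain i where i: "i < k" "{v. x v \<noteq> 0} = facet i" "0 < min_coord i x"
      "barycentric d (\<lambda>j. x (e i j))" "simplex_to_sphere d (\<lambda>j. x (e i j)) \<noteq> nsphere_basepoint"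
      "collapse x = sphere_inclusion i (simplex_to_sphere d (\<lambda>j. x (e i j)))"
      using notin[OF x] False by blast
    obtain i' where i': "i' < k" "{v. y v \<noteq> 0} = facet i'" "0 < min_coord i' y"
      "barycentric d (\<lambda>j. y (e i' j))"
      "collapse y = sphere_inclusion i' (simplex_to_sphere d (\<lambda>j. y (e i' j)))"
      using notin[OF y] False by blast
    have ii: "i' = i"
      and ss: "simplex_to_sphere d (\<lambda>j. x (e i j)) = simplex_to_sphere d (\<lambda>j. y (e i' j))"
      using eq i(5) unfolding i(6) i'(5) sphere_inclusion_eq_iff by blast+
    have "x (e i j) = y (e i j)" if "j \<le> d" for j
      using simplex_to_sphere_inj[OF i(4,3) i'(4,3)[unfolded ii] ss[unfolded ii] that] .
    moreover have "x v = y v" if "v \<notin> facet i" for v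
    proof -
      have "v \<notin> {v. x v \<noteq> 0}" "v \<notin> {v. y v \<noteq> 0}" unfolding i(2) i'(2) ii using that by blast+
      then show ?thesis by simp
    qed
    ultimately have "x v = y v" for v by (cases "v \<in> facet i") auto
    then show ?thesis by blast
  qed
qed

lemma collapse_surj: "collapse ` topspace X = topspace (wedge_of_spheres k d)"
proof (intro equalityI subsetI)
  fix w assume "w \<in> collapse ` topspace X"
  then obtain x where x: "x \<in> topspace X" "w = collapse x" by blast
  show "w \<in> topspace (wedge_of_spheres k d)"
  proof (cases "x \<in> A")
    case True
    then show ?thesis using x collapse_A by (simp add: topspace_wedge_of_spheres)
  next
    case False
    then obtain i where i: "i < k" "{v. x v \<noteq> 0} = facet i" using not_A_cases[OF x(1)] by blast
    then show ?thesis
      using x collapse_facet[OF x(1) i(1)] simplex_to_sphere_in[OF barycentric_facet[OF x(1) i(1)]]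
      by (auto simp: topspace_wedge_of_spheres)
  qed
next
  fix w assume w: "w \<in> topspace (wedge_of_spheres k d)"
  show "w \<in> collapse ` topspace X"
  proof (cases "w = None")
    case True
    \<comment> \<open>The basepoint is hit exactly by the points of \<open>D\<close>, of which there
      must be one.\<close>
    obtain x where "x \<in> A" using nonempty unfolding D_def[symmetric] by blast
    then show ?thesis using True collapse_A in_A_iff by (metis imageI)
  next
    case False
    then obtain i s where i: "i < k" "s \<in> topspace (nsphere d)" "w = sphere_inclusion i s"
      using w by (auto simp: topspace_wedge_of_spheres)
    then have "s \<noteq> nsphere_basepoint" using False sphere_inclusion_eq_None_iff by metis
    then obtain y where y: "barycentric d y" "simplex_to_sphere d y = s"
      using simplex_to_sphere_surj[OF i(2)] by metis
    define x where "x v = (if v \<in> facet i then y (inv_into {..d} (e i) v) else 0)" for v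
    have xe: "x (e i j) = y j" if "j \<le> d" for j
      using that inj_e[OF i(1)] by (simp add: x_def)
    have sub: "{v. x v \<noteq> 0} \<subseteq> facet i" by (auto simp: x_def)
    have "0 \<le> x v" for v
    proof (cases "v \<in> facet i")
      case True
      then show ?thesis using xe y(1) by (auto simp: barycentric_def)
    qed (simp add: x_def)
    moreover have "{v. x v \<noteq> 0} \<in> K" using finite_complexD(2)[OF K facet_in[OF i(1)] sub] .
    moreover have "sum x (\<Union>K) = sum x (facet i)"
      using sub facet_in[OF i(1)] finite_vertices by (intro sum.mono_neutral_right) auto
    moreover have "sum x (facet i) = sum y {..d}"
      using inj_e[OF i(1)] xe by (simp add: sum.reindex)
    ultimately have x: "x \<in> topspace X" using y(1) by (simp add: in_X_iff barycentric_def)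
    have "simplex_to_sphere d (\<lambda>j. x (e i j)) = simplex_to_sphere d y"
    proof -
      have "(\<lambda>j. x (e i j)) ` {..d} = y ` {..d}" using xe by (intro image_cong) auto
      moreover have "(\<Sum>j=1..d. (x (e i j) - x (e i 0))\<^sup>2) = (\<Sum>j=1..d. (y j - y 0)\<^sup>2)"
        using xe by (intro sum.cong) auto
      ultimately show ?thesis using xe by (auto simp: simplex_to_sphere_def Let_def)
    qed
    then have "collapse x = w" using collapse_facet[OF x i(1) sub] y(2) i(3) by simp
    then show ?thesis using x by blast
  qed
qed

lemma continuous_map_collapse: "continuous_map X (wedge_of_spheres k d) collapse"
proof -
  \<comment> \<open>A finite closed cover: for \<open>i < k\<close> the closed facet, where its
    coordinates sum to 1; for \<open>i = k\<close> the realization of \<open>D\<close>, where every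
    \<open>min_coord\<close> vanishes.\<close>
  define T where "T i = (if i < k then {x \<in> topspace X. (\<Sum>j\<le>d. x (e i j)) \<in> {1}}
    else {x \<in> topspace X. (\<Sum>j<k. min_coord j x) \<in> {0}})" for i
  define f where "f i = (if i < k then (\<lambda>x. sphere_inclusion i (simplex_to_sphere d (\<lambda>j. x (e i j))))
    else (\<lambda>_. None))" for i
  have T1: "{v. x v \<noteq> 0} \<subseteq> facet i" if "i < k" "x \<in> T i" for i x
  proof -
    have x: "x \<in> topspace X" "sum x (facet i) = 1"
      using that inj_e[OF that(1)] by (auto simp: sum.reindex T_def)
    have sub: "facet i \<subseteq> \<Union>K" using facet_in[OF that(1)] by blast
    have "sum x (\<Union>K) = sum x (\<Union>K - facet i) + sum x (facet i)"
      using sub finite_vertices by (rule sum.subset_diff)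
    then have "sum x (\<Union>K - facet i) = 0" using x by (simp add: in_X_iff)
    then have "\<forall>v\<in>\<Union>K - facet i. x v = 0"
      using finite_vertices x(1) by (subst (asm) sum_nonneg_eq_0_iff) (auto simp: in_X_iff)
    then show ?thesis using x(1) by (auto simp: in_X_iff)
  qed
  have T2: "x \<in> A" if "\<not> i < k" "x \<in> T i" for i x
  proof (rule ccontr)
    assume "x \<notin> A"
    moreover have x: "x \<in> topspace X" "(\<Sum>j<k. min_coord j x) = 0" using that by (auto simp: T_def)
    ultimately obtain j where j: "j < k" "{v. x v \<noteq> 0} = facet j" using not_A_cases by blast
    then show False
      using sum_min_coord[OF x(1) j, of "\<lambda>_ t. t"] x(2) min_coord_pos_iff[OF x(1) j(1)] by simp
  qed
  have T3: "x \<in> topspace X" if "x \<in> T i" for i x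
    using that by (auto simp: T_def split: if_splits)
  have f_eq: "f i x = collapse x" if "x \<in> T i" for i x
  proof (cases "i < k")
    case True
    then show ?thesis using collapse_facet[OF T3[OF that] True T1[OF True that]] by (simp add: f_def)
  next
    case False
    then show ?thesis using collapse_A[OF T2[OF False that]] by (simp add: f_def)
  qed
  show ?thesis
  proof (rule pasting_lemma_closed[where T = T and f = f and I = "{..k}"])
    show "closedin X (T i)" for i
    proof -
      have c1: "continuous_map X euclideanreal (\<lambda>x. \<Sum>j\<le>d. x (e i j))"
        by (intro continuous_map_sum continuous_map_realization_coordinate) auto
      have c2: "continuous_map X euclideanreal (\<lambda>x. \<Sum>j<k. min_coord j x)"
        by (intro continuous_map_sum continuous_map_min_coord) auto
      show ?thesis
        unfolding T_def
        using closedin_continuous_map_preimage[OF c1, of "{1}"]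
          closedin_continuous_map_preimage[OF c2, of "{0}"] by auto
    qed
    show "continuous_map (subtopology X (T i)) (wedge_of_spheres k d) (f i)" for i
    proof (cases "i < k")
      case True
      have "continuous_map (subtopology X (T i)) (nsphere d) (\<lambda>x. simplex_to_sphere d (\<lambda>j. x (e i j)))"
      proof (rule continuous_map_simplex_to_sphere)
        show "continuous_map (subtopology X (T i)) euclideanreal (\<lambda>x. x (e i j))" for j
          by (intro continuous_map_from_subtopology continuous_map_realization_coordinate)
        show "barycentric d (\<lambda>j. x (e i j))" if "x \<in> topspace (subtopology X (T i))" for x
          using that T1[OF True, of x] True by (intro barycentric_facet) auto
      qed
      from continuous_map_compose[OF this continuous_map_sphere_inclusion[OF True]]
      show ?thesis using True by (simp add: o_def f_def)
    qed (simp add: topspace_wedge_of_spheres f_def)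
    show "f i x = f j x" if "x \<in> topspace X \<inter> T i \<inter> T j" for i j x
      using that f_eq by (metis IntD1 IntD2)
    show "\<exists>j. j \<in> {..k} \<and> x \<in> T j \<and> collapse x = f j x" if x: "x \<in> topspace X" for x
    proof (cases "x \<in> A")
      case True
      have "(\<Sum>j<k. min_coord j x) = 0"
        using True min_coord_eq_0[OF x] by (intro sum.neutral) (auto simp: in_A_iff)
      then have "x \<in> T k" using x unfolding T_def by auto
      then show ?thesis using f_eq by (metis atMost_iff order_refl)
    next
      case False
      then obtain i where i: "i < k" "{v. x v \<noteq> 0} = facet i" using not_A_cases x by blast
      then have "x \<in> T i"
        using x barycentric_facet[OF x i(1)] unfolding T_def by (auto simp: barycentric_def)
      then show ?thesis using f_eq i(1) by (metis atMost_iff less_imp_le)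
    qed
  qed simp
qed

text \<open>Extension of a homotopy of \<open>D\<close> to \<open>X\<close>: up to time \<open>t\<close>, a point of a removed facet moves
  radially away from the barycentre; if it reaches the boundary before time \<open>t\<close>, it then
  follows the given homotopy for the remaining time.\<close>

definition push :: "real \<times> ('a \<Rightarrow> real) \<Rightarrow> nat \<Rightarrow> real" where
  "push = (\<lambda>(t, x) i. min (min_coord i x) (t / (2 * real (Suc d))))"

definition pushed :: "real \<times> ('a \<Rightarrow> real) \<Rightarrow> 'a \<Rightarrow> real" where
  "pushed z v = (snd z v - (\<Sum>i<k. push z i * indicator (facet i) v)) /
     (1 - real (Suc d) * (\<Sum>i<k. push z i))"

definition remaining :: "real \<times> ('a \<Rightarrow> real) \<Rightarrow> real" where
  "remaining z = fst z - 2 * real (Suc d) * (\<Sum>i<k. push z i)"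

lemma push_sums:
  assumes "x \<in> topspace X" "0 \<le> t"
  shows "x \<in> A \<Longrightarrow> (\<Sum>i<k. push (t, x) i * c i) = 0"
    and "i < k \<Longrightarrow> {v. x v \<noteq> 0} = facet i \<Longrightarrow> (\<Sum>j<k. push (t, x) j * c j) = push (t, x) i * c i"
proof -
  have *: "min 0 (t / (2 * real (Suc d))) = 0" using assms(2) by (intro min_absorb1) simp
  show "(\<Sum>i<k. push (t, x) i * c i) = 0" if "x \<in> A"
    using that min_coord_eq_0[OF assms(1)] *
    by (intro sum.neutral) (auto simp: push_def in_A_iff)
  show "(\<Sum>j<k. push (t, x) j * c j) = push (t, x) i * c i"
    if "i < k" "{v. x v \<noteq> 0} = facet i"
    using sum_min_coord[OF assms(1) that, of "\<lambda>j m. min m (t / (2 * real (Suc d))) * c j"] *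
    by (simp add: push_def)
qed

lemma pushed_A:
  assumes "x \<in> A" "0 \<le> t"
  shows "pushed (t, x) = x" "remaining (t, x) = t"
proof -
  have x: "x \<in> topspace X" using assms(1) by (simp add: in_A_iff)
  show "pushed (t, x) = x" "remaining (t, x) = t"
    using push_sums(1)[OF x assms(2,1), of "\<lambda>_. 1"]
      push_sums(1)[OF x assms(2,1), of "\<lambda>i. indicator (facet i) _"]
    by (simp_all add: pushed_def remaining_def fun_eq_iff)
qed

lemma pushed_facet:
  assumes x: "x \<in> topspace X" and i: "i < k" "{v. x v \<noteq> 0} = facet i" and t: "0 \<le> t" "t \<le> 1"
  shows "pushed (t, x) \<in> topspace X" "0 \<le> remaining (t, x)" "remaining (t, x) \<le> 1"
    "min_coord i x \<le> t / (2 * real (Suc d)) \<Longrightarrow> pushed (t, x) \<in> A"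
    "t / (2 * real (Suc d)) \<le> min_coord i x \<Longrightarrow> remaining (t, x) = 0"
proof -
  define s where "s = push (t, x) i"
  have m0: "0 \<le> min_coord i x" using min_coord_nonneg[OF x] .
  have s: "0 \<le> s" "s \<le> min_coord i x" "s \<le> t / (2 * real (Suc d))"
    using m0 t by (simp_all add: s_def push_def)
  then have s2: "2 * real (Suc d) * s \<le> t" by (simp add: field_simps)
  define n where "n = 1 - real (Suc d) * s"
  \<comment> \<open>The rate \<open>1 / (2 * real (Suc d))\<close> is chosen for this: each of the
    \<open>Suc d\<close> vertices loses at most that much, so at least half of the mass is left to
    renormalise.\<close>
  have n: "1 / 2 \<le> n" using s2 t unfolding n_def mult.assoc by linarith
  have p: "pushed (t, x) v = (x v - s * indicator (facet i) v) / n" for v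
    using push_sums(2)[OF x t(1) i, of "\<lambda>_. 1"] push_sums(2)[OF x t(1) i, of "\<lambda>i. indicator (facet i) v"]
    by (simp add: pushed_def n_def s_def)
  have r: "remaining (t, x) = t - 2 * real (Suc d) * s"
    using push_sums(2)[OF x t(1) i, of "\<lambda>_. 1"] by (simp add: remaining_def s_def)
  have s_le: "s \<le> x v" if "v \<in> facet i" for v
    using that s(2) by auto
  have "0 \<le> pushed (t, x) v" for v
    using s_le[of v] n x unfolding p by (cases "v \<in> facet i") (auto simp: in_X_iff)
  moreover have sub: "{v. pushed (t, x) v \<noteq> 0} \<subseteq> facet i"
    using i(2) unfolding p by (auto simp: indicator_def split: if_splits)
  then have inK: "{v. pushed (t, x) v \<noteq> 0} \<in> K"
    using finite_complexD(2)[OF K facet_in[OF i(1)]] by blast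
  moreover have "sum (pushed (t, x)) (\<Union>K) = 1"
  proof -
    have fin: "facet i \<subseteq> \<Union>K" using facet_in[OF i(1)] by blast
    have "sum (indicator (facet i)) (\<Union>K) = (\<Sum>v\<in>facet i. 1::real)"
      using fin finite_vertices by (intro sum.mono_neutral_cong_right) auto
    also have "\<dots> = real (card (facet i))" by simp
    also have "card (facet i) = Suc d" using inj_e[OF i(1)] by (simp add: card_image)
    finally have "sum (pushed (t, x)) (\<Union>K) = (sum x (\<Union>K) - s * real (Suc d)) / n"
      unfolding p by (simp only: sum_divide_distrib[symmetric] sum_subtractf sum_distrib_left[symmetric])
    also have "\<dots> = 1" using x n by (simp add: in_X_iff n_def mult.commute)
    finally show ?thesis .
  qed
  ultimately show pX: "pushed (t, x) \<in> topspace X" by (simp add: in_X_iff)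
  show "0 \<le> remaining (t, x)" using s2 by (simp add: r)
  have "0 \<le> 2 * real (Suc d) * s" using s(1) by simp
  then show "remaining (t, x) \<le> 1" using t(2) unfolding r by linarith
  show "remaining (t, x) = 0" if "t / (2 * real (Suc d)) \<le> min_coord i x"
    using that by (simp add: r s_def push_def min_absorb2)
  show "pushed (t, x) \<in> A" if "min_coord i x \<le> t / (2 * real (Suc d))"
  proof -
    have "s = min_coord i x" using that by (simp add: s_def push_def min_absorb1)
    moreover have "min_coord i x \<in> (\<lambda>j. x (e i j)) ` {..d}" by (intro Min_in) auto
    ultimately obtain j where "j \<le> d" "s = x (e i j)" by (metis (no_types, lifting) atMost_iff imageE)
    then have "pushed (t, x) (e i j) = 0" by (simp add: p)
    then have "{v. pushed (t, x) v \<noteq> 0} \<noteq> facet i" using \<open>j \<le> d\<close> by blast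
    \<comment> \<open>The support lies in \<open>facet i\<close>, so it can fill a facet
      \<open>l\<close> only if the two facets coincide.\<close>
    moreover have "{v. pushed (t, x) v \<noteq> 0} = facet i" if "l < k" "{v. pushed (t, x) v \<noteq> 0} = facet l" for l
      using facet_maximal[OF that(1) facet_in[OF i(1)]] that(2) sub by simp
    ultimately show ?thesis using pX unfolding in_A_iff by blast
  qed
qed

lemma homotopy_equivalent_wedge_of_spheres: "X homotopy_equivalent_space wedge_of_spheres k d"
proof -
  let ?IX = "prod_topology (top_of_set {0..1::real}) X"
  obtain a where "homotopic_with (\<lambda>x. True) (geometric_realization D) (geometric_realization D) id (\<lambda>x. a)"
    using contractible unfolding D_def[symmetric] contractible_space_def by blast
  then obtain h :: "real \<times> ('a \<Rightarrow> real) \<Rightarrow> 'a \<Rightarrow> real" where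
    h: "continuous_map (prod_topology (top_of_set {0..1}) (geometric_realization D))
      (geometric_realization D) h"
    and h0: "\<And>x. h (0, x) = x" and h1: "\<And>x. h (1, x) = a"
    unfolding homotopic_with_def by auto
  have hA: "h (t, x) \<in> A" if "0 \<le> t" "t \<le> 1" "x \<in> A" for t x
    using h that by (auto simp: continuous_map_def)
  define M where "M z = (\<Sum>i<k. min_coord i (snd z))" for z :: "real \<times> ('a \<Rightarrow> real)"
  define c where "c z = fst z / (2 * real (Suc d))" for z :: "real \<times> ('a \<Rightarrow> real)"
  \<comment> \<open>Where \<open>M z = c z\<close>, the remaining time is 0 and
    \<open>h (0, x) = x\<close>, so the branches agree. On \<open>A\<close> the function
    \<open>M\<close> vanishes and \<open>H\<close> is \<open>h\<close>.\<close>
  define H where "H z = (if M z \<le> c z then h (remaining z, pushed z) else pushed z)" for z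
  have M_A: "M (t, x) = 0" if "x \<in> A" for t x
    using that min_coord_eq_0 by (auto simp: M_def in_A_iff)
  have M_facet: "M (t, x) = min_coord i x" if "x \<in> topspace X" "i < k" "{v. x v \<noteq> 0} = facet i" for t x i
    using sum_min_coord[OF that, of "\<lambda>_ t. t"] by (simp add: M_def)
  have c0: "0 \<le> c (t, x)" if "0 \<le> t" for t x using that by (simp add: c_def)
  have pX: "pushed (t, x) \<in> topspace X" and r01: "0 \<le> remaining (t, x)" "remaining (t, x) \<le> 1"
    and pA: "M (t, x) \<le> c (t, x) \<Longrightarrow> pushed (t, x) \<in> A"
    and r0: "c (t, x) \<le> M (t, x) \<Longrightarrow> remaining (t, x) = 0"
    if x: "x \<in> topspace X" and t: "0 \<le> t" "t \<le> 1" for t x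
  proof -
    have "pushed (t, x) \<in> topspace X \<and> 0 \<le> remaining (t, x) \<and> remaining (t, x) \<le> 1 \<and>
      (M (t, x) \<le> c (t, x) \<longrightarrow> pushed (t, x) \<in> A) \<and> (c (t, x) \<le> M (t, x) \<longrightarrow> remaining (t, x) = 0)"
    proof (cases "x \<in> A")
      case True
      have "t \<le> 0" if "c (t, x) \<le> M (t, x)"
        using that M_A[OF True, of t] by (simp add: c_def field_simps)
      then show ?thesis using pushed_A[OF True t(1)] True x t by auto
    next
      case False
      then obtain i where i: "i < k" "{v. x v \<noteq> 0} = facet i" using not_A_cases[OF x] by blast
      have c: "c (t, x) = t / (2 * real (Suc d))" by (simp add: c_def)
      show ?thesis
        unfolding M_facet[OF x i] c using pushed_facet[OF x i t] by blast
    qed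
    then show "pushed (t, x) \<in> topspace X" "0 \<le> remaining (t, x)" "remaining (t, x) \<le> 1"
      "M (t, x) \<le> c (t, x) \<Longrightarrow> pushed (t, x) \<in> A"
      "c (t, x) \<le> M (t, x) \<Longrightarrow> remaining (t, x) = 0" by blast+
  qed
  have cont_c: "continuous_map ?IX euclideanreal c"
    unfolding c_def by (intro continuous_map_real_divide continuous_map_prod_interval_fst) auto
  have cont_M: "continuous_map ?IX euclideanreal M"
    unfolding M_def by (intro continuous_map_sum continuous_map_prod_min_coord) auto
  have cont_push: "continuous_map ?IX euclideanreal (\<lambda>z. push z i)" for i
  proof -
    have "continuous_map ?IX euclideanreal (\<lambda>z. min (min_coord i (snd z)) (c z))"
      by (intro continuous_map_real_min continuous_map_prod_min_coord cont_c)
    then show ?thesis by (simp add: push_def c_def case_prod_beta)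
  qed
  have cont_r: "continuous_map ?IX euclideanreal remaining"
    unfolding remaining_def
    by (intro continuous_map_diff continuous_map_prod_interval_fst continuous_map_real_mult
        continuous_map_sum cont_push) auto
  have cont_p: "continuous_map ?IX euclideanreal (\<lambda>z. pushed z v)" for v
    unfolding pushed_def
  proof (intro continuous_map_real_divide continuous_map_diff continuous_map_sum
      continuous_map_real_mult cont_push continuous_map_prod_realization_coordinate)
    fix z assume z: "z \<in> topspace ?IX"
    \<comment> \<open>Nonnegative remaining time and \<open>fst z \<le> 1\<close> bound the
      subtracted term by 1/2.\<close>
    have "remaining z \<ge> 0" "fst z \<le> 1" using r01(1)[of "snd z" "fst z"] z by auto
    then show "1 - real (Suc d) * (\<Sum>i<k. push z i) \<noteq> 0"
      unfolding remaining_def mult.assoc by linarith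
  qed auto
  have cont_pX: "continuous_map ?IX X pushed"
    unfolding continuous_map_into_realization using cont_p pX by auto
  have cont_H: "continuous_map ?IX X H"
    unfolding H_def
  proof (rule continuous_map_cases_le[OF cont_M cont_c])
    let ?S = "{z \<in> topspace ?IX. M z \<le> c z}"
    have "continuous_map (subtopology ?IX ?S) (prod_topology (top_of_set {0..1}) (geometric_realization D))
        (\<lambda>z. (remaining z, pushed z))"
    proof (intro continuous_map_paired[THEN iffD2] conjI)
      show "continuous_map (subtopology ?IX ?S) (top_of_set {0..1}) remaining"
        using continuous_map_from_subtopology[OF cont_r, of ?S] r01
        by (auto simp: continuous_map_in_subtopology)
      show "continuous_map (subtopology ?IX ?S) (geometric_realization D) pushed"
        unfolding continuous_map_into_realization
        using continuous_map_from_subtopology[OF cont_p, of ?S] pA by auto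
    qed
    from continuous_map_compose[OF this h]
    have "continuous_map (subtopology ?IX ?S) (geometric_realization D)
        (\<lambda>z. h (remaining z, pushed z))" by (simp add: o_def)
    then show "continuous_map (subtopology ?IX ?S) X (\<lambda>z. h (remaining z, pushed z))"
      unfolding continuous_map_into_realization by (auto simp: in_A_iff Pi_iff)
    show "continuous_map (subtopology ?IX {z \<in> topspace ?IX. c z \<le> M z}) X pushed"
      by (intro continuous_map_from_subtopology cont_pX)
    show "h (remaining z, pushed z) = pushed z" if "z \<in> topspace ?IX" "M z = c z" for z
      using that r0[of "snd z" "fst z"] h0 by auto
  qed
  have H_A: "H (t, x) = h (t, x)" if "x \<in> A" "0 \<le> t" for t x
    using pushed_A[OF that] M_A[OF that(1), of t] c0[OF that(2), of x] by (simp add: H_def)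
  have H0: "H (0, x) = x" if x: "x \<in> topspace X" for x
  proof (cases "x \<in> A")
    case True
    then show ?thesis using H_A h0 by simp
  next
    case False
    then obtain i where i: "i < k" "{v. x v \<noteq> 0} = facet i" using not_A_cases[OF x] by blast
    have "push (0, x) j = 0" for j
      using min_coord_nonneg[OF x, of j] by (simp add: push_def)
    then have "pushed (0, x) = x" "remaining (0, x) = 0"
      by (simp_all add: pushed_def remaining_def fun_eq_iff)
    then show ?thesis using h0 by (simp add: H_def)
  qed
  show ?thesis
  proof (rule homotopy_equivalent_quotient[OF compact_realization[OF K]
        Hausdorff_wedge_of_spheres[OF k_pos] _ continuous_map_collapse collapse_surj collapse_inj _ cont_H])
    show "A \<subseteq> topspace X" by (auto simp: in_A_iff)
    show "collapse x = collapse y" if "x \<in> A" "y \<in> A" for x y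
      using that collapse_A by metis
    show "H (t, x) \<in> A" if "0 \<le> t" "t \<le> 1" "x \<in> A" for t x
      using H_A hA that by simp
    show "H (1, x) = a" if "x \<in> A" for x using H_A h1 that by simp
  qed (use H0 in auto)
qed

end

section \<open>Critical facets\<close>

text \<open>\<open>c\<close> is a cardinality, one more than the dimension, so the empty simplex can
  be critical with \<open>c = 0\<close>. Maximality is not recorded, since a set maximal in the
  deletion of \<open>v\<close> may still extend by \<open>v\<close>; a dimension bound restores it
  at the end.\<close>

definition critical_facets :: "'a set set \<Rightarrow> nat \<Rightarrow> nat \<Rightarrow> bool" where
  "critical_facets K c m \<longleftrightarrow> (\<exists>F. finite F \<and> card F = m \<and> F \<subseteq> K \<and>
     (\<forall>\<sigma>\<in>F. finite \<sigma> \<and> card \<sigma> = c) \<and> collapsible (K - F))"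

lemma critical_facets_cone:
  assumes "\<And>\<sigma>. \<sigma> \<in> K \<Longrightarrow> insert w \<sigma> \<in> K"
  shows "critical_facets K c 0"
  unfolding critical_facets_def
  using collapsible.cone[of K w] assms by (intro exI[of _ "{}"]) auto

lemma critical_facets_link_deletion:
  assumes "critical_facets (link v K) c a" and "critical_facets (deletion v K) (Suc c) b"
  shows "critical_facets K (Suc c) (a + b)"
proof -
  obtain F where F: "finite F" "card F = a" "F \<subseteq> link v K" "\<forall>\<sigma>\<in>F. finite \<sigma> \<and> card \<sigma> = c"
    "collapsible (link v K - F)"
    using assms(1) by (auto simp: critical_facets_def)
  obtain G where G: "finite G" "card G = b" "G \<subseteq> deletion v K"
    "\<forall>\<sigma>\<in>G. finite \<sigma> \<and> card \<sigma> = Suc c" "collapsible (deletion v K - G)"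
    using assms(2) by (auto simp: critical_facets_def)
  have vF: "v \<notin> \<sigma>" if "\<sigma> \<in> F" for \<sigma> using that F(3) by (auto simp: link_def)
  have inj: "inj_on (insert v) F"
    using vF by (intro inj_onI) (metis Diff_insert_absorb)
  have disj: "insert v ` F \<inter> G = {}" using G(3) by (auto simp: deletion_def)
  have ins: "insert v \<sigma> \<in> insert v ` F \<longleftrightarrow> \<sigma> \<in> F" if "v \<notin> \<sigma>" for \<sigma>
    using that vF by (auto simp: image_iff) (metis Diff_insert_absorb)
  have "link v (K - (insert v ` F \<union> G)) = link v K - F"
    using ins G(3) by (auto simp: link_def deletion_def)
  moreover have "deletion v (K - (insert v ` F \<union> G)) = deletion v K - G"
    by (auto simp: deletion_def)
  ultimately have "collapsible (K - (insert v ` F \<union> G))"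
    using F(5) G(5) by (rule_tac collapsible_link_deletion[of v]) simp_all
  moreover have "card (insert v ` F \<union> G) = a + b"
    using F G inj disj by (simp add: card_Un_disjoint card_image)
  moreover have "insert v ` F \<union> G \<subseteq> K"
    using F(3) G(3) by (auto simp: link_def deletion_def)
  moreover have "\<forall>\<sigma>\<in>insert v ` F \<union> G. finite \<sigma> \<and> card \<sigma> = Suc c"
    using F(4) G(4) vF by auto
  ultimately show ?thesis
    unfolding critical_facets_def using F(1) G(1) by (intro exI[of _ "insert v ` F \<union> G"]) auto
qed

text \<open>The bound on cardinalities makes the critical sets maximal. Removing them therefore
  leaves a complex, on which the collapse can be realised topologically.\<close>

lemma homotopy_equivalent_wedge_if_critical_facets:
  assumes K: "finite_complex K" and crit: "critical_facets K (Suc d) m" and m: "0 < m"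
    and dim: "\<And>\<sigma>. \<sigma> \<in> K \<Longrightarrow> card \<sigma> \<le> Suc d"
  shows "geometric_realization K homotopy_equivalent_space wedge_of_spheres m d"
proof -
  obtain F where F: "finite F" "card F = m" "F \<subseteq> K" "\<And>\<sigma>. \<sigma> \<in> F \<Longrightarrow> finite \<sigma>"
    "\<And>\<sigma>. \<sigma> \<in> F \<Longrightarrow> card \<sigma> = Suc d" "collapsible (K - F)"
    using crit unfolding critical_facets_def by blast
  obtain b where b: "bij_betw b {..<m} F"
    using ex_bij_betw_nat_finite[OF F(1)] F(2) by (auto simp: atLeast0LessThan)
  have "\<exists>e. bij_betw e {..d} \<sigma>" if "\<sigma> \<in> F" for \<sigma>
    using ex_bij_betw_nat_finite[OF F(4)[OF that]] F(5)[OF that]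
    by (auto simp: atLeast0LessThan lessThan_Suc_atMost)
  then obtain f where f: "\<And>\<sigma>. \<sigma> \<in> F \<Longrightarrow> bij_betw (f \<sigma>) {..d} \<sigma>" by metis
  have bF: "b i \<in> F" if "i < m" for i using b that by (auto simp: bij_betw_def)
  define e where "e i = f (b i)" for i
  have e: "inj_on (e i) {..d}" "e i ` {..d} = b i" if "i < m" for i
    using f[OF bF[OF that]] by (auto simp: e_def bij_betw_def)
  have F_eq: "(\<lambda>i. e i ` {..d}) ` {..<m} = F"
    using e(2) b by (auto simp: bij_betw_def)
  have maximal: "\<rho> = \<sigma>" if "\<sigma> \<in> F" "\<rho> \<in> K" "\<sigma> \<subseteq> \<rho>" for \<sigma> \<rho>
    using that F(5)[OF that(1)] dim[OF that(2)] finite_complexD(3)[OF K that(2)]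
    by (metis card_seteq)
  have "finite_complex (K - F)"
  proof (rule finite_complex_restrict[OF K])
    show "\<rho> \<in> K - F" if "\<sigma> \<in> K - F" "\<rho> \<subseteq> \<sigma>" "\<rho> \<in> K" for \<sigma> \<rho>
      using that maximal by blast
  qed auto
  moreover have "{} \<in> K - F"
  proof -
    have "{} \<in> K" using finite_complexD(2)[OF K _ empty_subsetI] F(3) bF[OF m] by blast
    moreover have "{} \<notin> F" using F(5) by fastforce
    ultimately show ?thesis by blast
  qed
  ultimately have "contractible_space (geometric_realization (K - F)) \<and>
      topspace (geometric_realization (K - F)) \<noteq> {}"
    using collapsible_imp_contractible[OF F(6)] by blast
  then interpret contractible_facet_complement K d m e
    by unfold_locales
      (use K m e b bF F(3) maximal F_eq in \<open>auto simp: bij_betw_def dest: inj_onD\<close>)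
  show ?thesis by (rule homotopy_equivalent_wedge_of_spheres)
qed

section \<open>Folding\<close>

text \<open>A collapse along the single vertex \<open>v\<close>, whose link is a cone with apex
  \<open>w\<close>. As a relation between complexes it also serves those that are not
  contractible.\<close>

definition fold_step :: "'a set set \<Rightarrow> 'a set set \<Rightarrow> bool" where
  "fold_step K L \<longleftrightarrow> (\<exists>v w. w \<noteq> v \<and> (\<forall>\<sigma>\<in>K. v \<in> \<sigma> \<longrightarrow> insert w \<sigma> \<in> K) \<and> L = deletion v K)"

lemma fold_step_homotopy_equivalent:
  assumes "fold_step K L" and K: "finite_complex K"
  shows "finite_complex L" "geometric_realization K homotopy_equivalent_space geometric_realization L"
proof -
  obtain v w where vw: "w \<noteq> v" "\<forall>\<sigma>\<in>K. v \<in> \<sigma> \<longrightarrow> insert w \<sigma> \<in> K" "L = deletion v K"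
    using assms(1) by (auto simp: fold_step_def)
  have L: "L = {\<sigma> \<in> K. \<not> {v} \<subseteq> \<sigma>}" by (auto simp: vw(3) deletion_def)
  show "finite_complex L"
    unfolding L by (rule finite_complex_restrict[OF K]) auto
  show "geometric_realization K homotopy_equivalent_space geometric_realization L"
    unfolding L using vw by (intro collapse_deformation[OF K, of _ w]) auto
qed

lemma folds_homotopy_equivalent:
  assumes "fold_step\<^sup>*\<^sup>* K L" and "finite_complex K"
  shows "finite_complex L \<and> geometric_realization K homotopy_equivalent_space geometric_realization L"
  using assms
proof (induction rule: rtranclp_induct)
  case (step L L')
  then show ?case
    using fold_step_homotopy_equivalent[OF step.hyps(2)] homotopy_eqv_trans by blast
qed (simp add: homotopy_equivalent_space_refl)

text \<open>Critical sets of a deletion avoid \<open>v\<close>, so removing them does not disturb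
  the step along \<open>{v}\<close>, where every \<open>insert w \<sigma>\<close> still contains
  \<open>v\<close>.\<close>

lemma critical_facets_folds:
  assumes "fold_step\<^sup>*\<^sup>* K L" and "critical_facets L c m"
  shows "critical_facets K c m"
  using assms
proof (induction rule: converse_rtranclp_induct)
  case (step K L)
  obtain v w where vw: "w \<noteq> v" "\<forall>\<sigma>\<in>K. v \<in> \<sigma> \<longrightarrow> insert w \<sigma> \<in> K" "L = deletion v K"
    using step.hyps(1) by (auto simp: fold_step_def)
  obtain F where F: "finite F" "card F = m" "F \<subseteq> L" "\<forall>\<sigma>\<in>F. finite \<sigma> \<and> card \<sigma> = c" "collapsible (L - F)"
    using step.IH[OF step.prems] by (auto simp: critical_facets_def)
  have "{\<sigma> \<in> K - F. \<not> {v} \<subseteq> \<sigma>} = L - F" by (auto simp: vw(3) deletion_def)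
  then have "collapsible (K - F)"
    using vw F(3,5) by (intro collapsible.step[of "{v}" w "K - F"]) (auto simp: deletion_def)
  then show ?case
    unfolding critical_facets_def using F vw(3) by (intro exI[of _ F]) (auto simp: deletion_def)
qed

section \<open>Complexes of matchings\<close>

text \<open>Edge sets replace graphs because links and deletions then stay within the same kind of
  complex.\<close>

definition matchings :: "'a set set \<Rightarrow> 'a set set set" where
  "matchings S = {M. M \<subseteq> S \<and> pairwise disjnt M}"

lemma finite_complex_matchings:
  assumes "finite S"
  shows "finite_complex (matchings S)"
  unfolding finite_complex_def
proof
  have "\<Union>(matchings S) \<subseteq> S" by (auto simp: matchings_def)
  then show "finite (\<Union>(matchings S))" using assms by (rule finite_subset)
qed (auto simp: matchings_def intro: pairwise_subset)

lemma insert_in_matchings_iff: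
  "insert e M \<in> matchings S \<longleftrightarrow> e \<in> S \<and> M \<in> matchings S \<and> (\<forall>f\<in>M. f \<noteq> e \<longrightarrow> disjnt f e)"
  by (auto simp: matchings_def pairwise_insert disjnt_sym)

lemma link_matchings:
  assumes "e \<in> S" "e \<noteq> {}"
  shows "link e (matchings S) = matchings {f \<in> S. disjnt f e}"
proof -
  have "\<not> disjnt e e" using assms(2) by (simp add: disjnt_def)
  then show ?thesis
    using assms(1) unfolding link_def insert_in_matchings_iff by (auto simp: matchings_def)
qed

lemma deletion_matchings: "deletion e (matchings S) = matchings (S - {e})"
  by (auto simp: deletion_def matchings_def)

text \<open>Every other edge that meets \<open>f\<close> also meets \<open>e\<close>, so a matching
  that uses \<open>e\<close> always has room for \<open>f\<close>.\<close>

lemma fold_step_matchings: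
  assumes "f \<in> S" "disjnt e f" "e \<noteq> f" and "\<And>g. g \<in> S \<Longrightarrow> disjnt g e \<Longrightarrow> g \<noteq> f \<Longrightarrow> disjnt g f"
  shows "fold_step (matchings S) (matchings (S - {e}))"
  unfolding fold_step_def
proof (intro exI conjI ballI impI)
  fix M assume M: "M \<in> matchings S" "e \<in> M"
  have "disjnt g f" if "g \<in> M" "g \<noteq> f" for g
  proof (cases "g = e")
    case False
    then have "disjnt g e" using M that by (auto simp: matchings_def pairwise_def)
    then show ?thesis using assms(4) M that by (auto simp: matchings_def)
  qed (use assms(2) in simp)
  then show "insert f M \<in> matchings S" using M assms(1) by (simp add: insert_in_matchings_iff)
qed (use assms in \<open>auto simp: deletion_matchings\<close>)

text \<open>The (-1)-sphere of the recursion: removing the empty matching from \<open>{{}}\<close>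
  leaves the empty family, vacuously a cone.\<close>

lemma critical_facets_no_edges: "critical_facets (matchings ({} :: 'a set set)) 0 1"
proof -
  have "matchings ({} :: 'a set set) = {{}}" by (auto simp: matchings_def)
  moreover have "collapsible ({} :: 'a set set set)" by (rule collapsible.cone) auto
  then have "critical_facets ({{}} :: 'a set set set) 0 1"
    unfolding critical_facets_def by (intro exI[of _ "{{}}"]) simp
  ultimately show ?thesis by simp
qed

lemma critical_facets_isolated_edge:
  assumes "f \<in> S" "\<And>g. g \<in> S \<Longrightarrow> g \<noteq> f \<Longrightarrow> disjnt g f"
  shows "critical_facets (matchings S) c 0"
  using assms
  by (intro critical_facets_cone[of _ f], simp only: insert_in_matchings_iff) (auto simp: matchings_def)

lemma critical_facets_edge:
  assumes "e \<in> S" "e \<noteq> {}" and "critical_facets (matchings {f \<in> S. disjnt f e}) c a"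
    and "critical_facets (matchings (S - {e})) (Suc c) b"
  shows "critical_facets (matchings S) (Suc c) (a + b)"
  using assms by (rule_tac critical_facets_link_deletion[of e]) (simp_all add: link_matchings deletion_matchings)

text \<open>Only the link of \<open>{x, y}\<close> contributes: it is \<open>matchings B\<close>,
  whereas deleting \<open>{x, y}\<close> isolates \<open>{x, z}\<close> and leaves a cone.\<close>

lemma critical_facets_isolated_path:
  assumes "y \<noteq> z" and B: "\<And>g. g \<in> B \<Longrightarrow> x \<notin> g \<and> y \<notin> g \<and> z \<notin> g"
    and crit: "critical_facets (matchings B) c m"
  shows "critical_facets (matchings ({{x, y}, {x, z}} \<union> B)) (Suc c) m"
proof -
  let ?S = "{{x, y}, {x, z}} \<union> B"
  have ne: "{x, z} \<noteq> {x, y}" using assms(1) by (auto simp: doubleton_eq_iff)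
  have "{f \<in> ?S. disjnt f {x, y}} = B"
    using B by (auto simp: disjnt_def)
  moreover have "critical_facets (matchings (?S - {{x, y}})) (Suc c) 0"
    using B ne by (intro critical_facets_isolated_edge[of "{x, z}"]) (auto simp: disjnt_def)
  ultimately show ?thesis
    using critical_facets_edge[of "{x, y}" ?S c m 0] crit by simp
qed

text \<open>In the situation of the next lemma, every other edge that meets \<open>{x, y}\<close> also meets \<open>{u, z}\<close>,
  and every other edge that meets \<open>{x, z}\<close> also meets \<open>{u, y}\<close>.\<close>

lemma folds_square:
  assumes dist: "x \<noteq> y" "x \<noteq> z" "y \<noteq> z" "u \<noteq> x" "u \<noteq> y" "u \<noteq> z"
    and B: "\<And>g. g \<in> B \<Longrightarrow> x \<notin> g \<and> y \<notin> g \<and> z \<notin> g"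
  shows "fold_step\<^sup>*\<^sup>* (matchings ({{u, y}, {u, z}} \<union> ({{x, y}, {x, z}} \<union> B)))
    (matchings ({{x, y}, {x, z}} \<union> B))"
proof -
  let ?P = "{{x, y}, {x, z}} \<union> B"
  have uz: "{u, z} \<notin> insert {u, y} ?P" and uy: "{u, y} \<notin> ?P"
    using dist B[of "{u, z}"] B[of "{u, y}"] by (auto simp: doubleton_eq_iff)
  have "fold_step (matchings (insert {u, z} (insert {u, y} ?P)))
      (matchings (insert {u, z} (insert {u, y} ?P) - {{u, z}}))"
    using dist B by (intro fold_step_matchings[of "{x, y}"]) (auto simp: doubleton_eq_iff disjnt_def)
  then have 1: "fold_step (matchings (insert {u, z} (insert {u, y} ?P))) (matchings (insert {u, y} ?P))"
    using uz by simp
  have "fold_step (matchings (insert {u, y} ?P)) (matchings (insert {u, y} ?P - {{u, y}}))"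
    using dist B by (intro fold_step_matchings[of "{x, z}"]) (auto simp: doubleton_eq_iff disjnt_def)
  then have 2: "fold_step (matchings (insert {u, y} ?P)) (matchings ?P)"
    using uy by simp
  have "{{u, y}, {u, z}} \<union> ?P = insert {u, z} (insert {u, y} ?P)" by auto
  then show ?thesis
    using converse_rtranclp_into_rtranclp[of fold_step, OF 1 r_into_rtranclp[of fold_step, OF 2]]
    by (simp only:)
qed

text \<open>The vertex-cover bound: choosing a covering vertex in each edge is injective on disjoint
  edges.\<close>

lemma card_matching_le:
  assumes "M \<in> matchings S" "finite C" "\<And>f. f \<in> S \<Longrightarrow> \<exists>v\<in>C. v \<in> f"
  shows "card M \<le> card C"
proof -
  obtain c where c: "\<And>f. f \<in> S \<Longrightarrow> c f \<in> C \<and> c f \<in> f" using assms(3) by metis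
  have "inj_on c M"
  proof (rule inj_onI)
    fix f g assume fg: "f \<in> M" "g \<in> M" "c f = c g"
    then have "\<not> disjnt f g" using c assms(1) by (auto simp: matchings_def disjnt_iff subset_iff) metis
    then show "f = g" using fg assms(1) by (auto simp: matchings_def pairwise_def)
  qed
  moreover have "c ` M \<subseteq> C" using c assms(1) by (auto simp: matchings_def)
  ultimately show ?thesis using card_inj_on_le assms(2) by blast
qed

section \<open>Chains of squares\<close>

text \<open>Up to the index \<open>N\<close>, a pair \<open>y i, z i\<close> precedes the vertex \<open>x i\<close>, which in turn precedes
  the pair \<open>y (Suc i), z (Suc i)\<close>. Both components of \<open>P\<^sub>m \<times> P\<^sub>3\<close> have this shape.\<close>

locale chain =
  fixes x y z :: "nat \<Rightarrow> 'a" and N :: nat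
  assumes inj_xyz: "inj_on x {..N}" "inj_on y {..N}" "inj_on z {..N}"
    and dist_xyz: "x i \<noteq> y j" "x i \<noteq> z j" "y i \<noteq> z j"
begin

definition left :: "nat \<Rightarrow> 'a set set" where "left i = {{x i, y i}, {x i, z i}}"

definition right :: "nat \<Rightarrow> 'a set set" where "right i = {{x i, y (Suc i)}, {x i, z (Suc i)}}"

text \<open>In the applications \<open>b\<close> is 0, or 1 for a chain in which no pair precedes
  \<open>x 0\<close>.\<close>

definition lefts :: "nat \<Rightarrow> nat \<Rightarrow> 'a set set" where "lefts b a = (\<Union>i\<in>{b..<a}. left i)"

definition rights :: "nat \<Rightarrow> 'a set set" where "rights a = (\<Union>i<a. right i)"

lemma index_eq_iff:
  assumes "i \<le> N" "j \<le> N"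
  shows "x i = x j \<longleftrightarrow> i = j" "y i = y j \<longleftrightarrow> i = j" "z i = z j \<longleftrightarrow> i = j"
  using assms inj_xyz by (simp_all add: inj_on_eq_iff)

lemma dist_simps [simp]:
  "x i \<noteq> y j" "x i \<noteq> z j" "y i \<noteq> z j" "y j \<noteq> x i" "z j \<noteq> x i" "z j \<noteq> y i"
  using dist_xyz by metis+

lemma lefts_Suc: "b \<le> a \<Longrightarrow> lefts b (Suc a) = left a \<union> lefts b a"
  by (auto simp: lefts_def atLeastLessThanSuc)

lemma lefts_empty: "a \<le> b \<Longrightarrow> lefts b a = {}"
  by (auto simp: lefts_def)

lemma rights_0: "rights 0 = {}"
  by (simp add: rights_def)

lemma rights_Suc: "rights (Suc a) = right a \<union> rights a"
  by (auto simp: rights_def lessThan_Suc)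

lemma not_in_lefts:
  assumes "g \<in> lefts b a" "a \<le> i" "i \<le> N"
  shows "x i \<notin> g" "y i \<notin> g" "z i \<notin> g"
  using assms by (auto simp: lefts_def left_def index_eq_iff)

lemma not_in_rights:
  assumes "g \<in> rights a"
  shows "a \<le> i \<Longrightarrow> i \<le> N \<Longrightarrow> x i \<notin> g" "a < i \<Longrightarrow> i \<le> N \<Longrightarrow> y i \<notin> g" "a < i \<Longrightarrow> i \<le> N \<Longrightarrow> z i \<notin> g"
  using assms by (auto simp: rights_def right_def index_eq_iff)

text \<open>No pair follows the last vertex, so it forms a square with its predecessor and the pair
  between them, and \<open>folds_square\<close> strips off the right edges of the predecessor. The
  left edges of the last vertex then form a separate path and join \<open>R\<close>, hence the
  induction over arbitrary \<open>R\<close>.\<close>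

lemma folds_chain:
  assumes "b \<le> 1" "a \<le> N" and "\<And>g i. g \<in> R \<Longrightarrow> i \<le> a \<Longrightarrow> x i \<notin> g \<and> y i \<notin> g \<and> z i \<notin> g"
  shows "fold_step\<^sup>*\<^sup>* (matchings (rights a \<union> lefts b (Suc a) \<union> R)) (matchings (lefts b (Suc a) \<union> R))"
  using assms(2,3)
proof (induction a arbitrary: R)
  case 0
  then show ?case by (simp add: rights_0)
next
  case (Suc a)
  let ?B = "rights a \<union> lefts b (Suc a) \<union> R"
  have b: "b \<le> Suc a" using assms(1) by simp
  have B: "x (Suc a) \<notin> g \<and> y (Suc a) \<notin> g \<and> z (Suc a) \<notin> g" if "g \<in> ?B" for g
    using that not_in_lefts[of g b "Suc a" "Suc a"] not_in_rights[of g a "Suc a"] Suc.prems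
    by auto
  have "fold_step\<^sup>*\<^sup>* (matchings (right a \<union> (left (Suc a) \<union> ?B))) (matchings (left (Suc a) \<union> ?B))"
    unfolding left_def right_def
    using B Suc.prems(1) by (intro folds_square) (auto simp: index_eq_iff)
  moreover have "fold_step\<^sup>*\<^sup>* (matchings (rights a \<union> lefts b (Suc a) \<union> (left (Suc a) \<union> R)))
      (matchings (lefts b (Suc a) \<union> (left (Suc a) \<union> R)))"
  proof (rule Suc.IH)
    fix g i assume g: "g \<in> left (Suc a) \<union> R" "i \<le> a"
    show "x i \<notin> g \<and> y i \<notin> g \<and> z i \<notin> g"
      using g Suc.prems by (auto simp: left_def index_eq_iff)
  qed (use Suc.prems in simp)
  moreover have "rights (Suc a) \<union> lefts b (Suc (Suc a)) \<union> R = right a \<union> (left (Suc a) \<union> ?B)"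
    "left (Suc a) \<union> ?B = rights a \<union> lefts b (Suc a) \<union> (left (Suc a) \<union> R)"
    "lefts b (Suc (Suc a)) \<union> R = lefts b (Suc a) \<union> (left (Suc a) \<union> R)"
    using b by (auto simp: lefts_Suc rights_Suc)
  ultimately show ?case by simp
qed

lemma critical_facets_lefts:
  assumes "critical_facets (matchings R) c m" "b \<le> a" "a \<le> Suc N"
    and "\<And>g i. g \<in> R \<Longrightarrow> i < a \<Longrightarrow> x i \<notin> g \<and> y i \<notin> g \<and> z i \<notin> g"
  shows "critical_facets (matchings (lefts b a \<union> R)) (c + (a - b)) m"
  using assms(2,3,4)
proof (induction a rule: dec_induct)
  case base
  show ?case using assms(1) by (simp add: lefts_empty)
next
  case (step a)
  have "critical_facets (matchings (lefts b a \<union> R)) (c + (a - b)) m"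
    by (rule step.IH) (use step.prems in auto)
  moreover have "x a \<notin> g \<and> y a \<notin> g \<and> z a \<notin> g" if "g \<in> lefts b a \<union> R" for g
    using that step.prems not_in_lefts[of g b a a] by auto
  ultimately have "critical_facets (matchings (left a \<union> (lefts b a \<union> R))) (Suc (c + (a - b))) m"
    unfolding left_def by (intro critical_facets_isolated_path) simp_all
  then show ?case using step.hyps by (simp add: lefts_Suc Suc_diff_le Un_assoc)
qed

lemma critical_facets_full_chain:
  assumes "critical_facets (matchings R) c 1" "a \<le> N"
    and "\<And>g i. g \<in> R \<Longrightarrow> i \<le> a \<Longrightarrow> x i \<notin> g \<and> y i \<notin> g \<and> z i \<notin> g"
  shows "critical_facets (matchings (rights a \<union> lefts 0 a \<union> R)) (c + a) (2 ^ (a + 1) - 1)"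
  using assms(2,3)
proof (induction a)
  case 0
  then show ?case using assms(1) by (simp add: rights_0 lefts_empty)
next
  case (Suc a)
  \<comment> \<open>\<open>?T\<close> is the chain without its last pair; the edges
    \<open>?f\<close> and \<open>?e\<close> to that pair are put back one at a time.\<close>
  let ?T = "rights a \<union> lefts 0 (Suc a) \<union> R"
  let ?e = "{x a, y (Suc a)}" and ?f = "{x a, z (Suc a)}"
  have ne: "?e \<noteq> ?f" by (auto simp: doubleton_eq_iff)
  have notT: "y (Suc a) \<notin> g \<and> z (Suc a) \<notin> g" if "g \<in> ?T" for g
    using that not_in_lefts[of g 0 "Suc a" "Suc a"] not_in_rights[of g a "Suc a"] Suc.prems by auto
  have notU: "x a \<notin> g" if "g \<in> rights a \<union> lefts 0 a \<union> R" for g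
    using that not_in_lefts[of g 0 a a] not_in_rights[of g a a] Suc.prems by auto
  have T: "?T = left a \<union> (rights a \<union> lefts 0 a \<union> R)" by (auto simp: lefts_Suc)
  have eT: "?e \<notin> ?T" "?f \<notin> ?T" using notT by blast+
  \<comment> \<open>Edges of \<open>?T\<close> avoid the last pair, so \<open>?e\<close> and
    \<open>?f\<close> meet exactly the edges through \<open>x a\<close>. Both links are thus the
    full chain shorter by one, whether or not the other edge is present.\<close>
  have link: "{g \<in> S. disjnt g h} = rights a \<union> lefts 0 a \<union> R"
    if "?T \<subseteq> S" "S \<subseteq> ?T \<union> {?e, ?f}" "h = ?e \<or> h = ?f" for S h
  proof -
    have "{g \<in> S. disjnt g h} \<subseteq> {g \<in> ?T. x a \<notin> g}"
      using that by (auto simp: disjnt_def)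
    moreover have "{g \<in> ?T. x a \<notin> g} \<subseteq> {g \<in> S. disjnt g h}"
      using that notT by (auto simp: disjnt_def)
    moreover have "{g \<in> ?T. x a \<notin> g} = rights a \<union> lefts 0 a \<union> R"
      unfolding T using notU by (auto simp: left_def)
    ultimately show ?thesis by blast
  qed
  have IH: "critical_facets (matchings (rights a \<union> lefts 0 a \<union> R)) (c + a) (2 ^ (a + 1) - 1)"
    using Suc by simp
  \<comment> \<open>The chain with a missing pair folds to isolated paths beside \<open>R\<close>;
    its one critical facet is the \<open>+ 1\<close> of the recursion.\<close>
  have "critical_facets (matchings ?T) (Suc (c + a)) 1"
  proof (rule critical_facets_folds[OF folds_chain])
    have "critical_facets (matchings (lefts 0 (Suc a) \<union> R)) (c + (Suc a - 0)) 1"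
      using assms(1) Suc.prems by (intro critical_facets_lefts) auto
    then show "critical_facets (matchings (lefts 0 (Suc a) \<union> R)) (Suc (c + a)) 1" by simp
  qed (use Suc.prems in auto)
  moreover have "insert ?f ?T - {?f} = ?T" using eT by simp
  moreover have "{g \<in> insert ?f ?T. disjnt g ?f} = rights a \<union> lefts 0 a \<union> R"
    by (rule link) auto
  ultimately have "critical_facets (matchings (insert ?f ?T)) (Suc (c + a)) (2 ^ (a + 1) - 1 + 1)"
    using IH by (rule_tac critical_facets_edge[of ?f]) simp_all
  moreover have "insert ?e (insert ?f ?T) - {?e} = insert ?f ?T" using eT ne by auto
  moreover have "{g \<in> insert ?e (insert ?f ?T). disjnt g ?e} = rights a \<union> lefts 0 a \<union> R"
    by (rule link) auto
  ultimately have "critical_facets (matchings (insert ?e (insert ?f ?T))) (Suc (c + a))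
      (2 ^ (a + 1) - 1 + (2 ^ (a + 1) - 1 + 1))"
    using IH by (rule_tac critical_facets_edge[of ?e]) simp_all
  moreover have "insert ?e (insert ?f ?T) = rights (Suc a) \<union> lefts 0 (Suc a) \<union> R"
    by (auto simp: rights_Suc right_def)
  moreover have "(2 ^ (a + 1) - 1 + (2 ^ (a + 1) - 1 + 1)) = (2 ^ (Suc a + 1) - 1 :: nat)"
  proof -
    have "1 \<le> (2::nat) ^ (a + 1)" by simp
    then show ?thesis unfolding add_Suc power_Suc by linarith
  qed
  ultimately show ?case by simp
qed

lemma finite_lefts: "finite (lefts b a)" and finite_rights: "finite (rights a)"
  by (auto simp: lefts_def rights_def left_def right_def)

end

section \<open>The product with a path on three vertices\<close>

lemma edges_path_graph_iff:
  "{u, u'} \<in> edges (path_graph k) \<longleftrightarrow>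
    u' = Suc u \<and> 1 \<le> u \<and> u < k \<or> u = Suc u' \<and> 1 \<le> u' \<and> u' < k"
  by (auto simp: path_graph_def doubleton_eq_iff)

lemma edge_stripE:
  assumes "g \<in> edges (categorical_product (path_graph m) (path_graph 3))"
  obtains i j c where "g = {(i, 2), (j, c)}" "1 \<le> i" "i \<le> m" "1 \<le> j" "j \<le> m"
    "j = Suc i \<or> i = Suc j" "c \<in> {1, 3}"
proof -
  obtain u v u' v' where g: "g = {(u, v), (u', v')}"
    "{u, u'} \<in> edges (path_graph m)" "{v, v'} \<in> edges (path_graph 3)"
    using assms by (auto simp: categorical_product_def)
  have u: "1 \<le> u" "u \<le> m" "1 \<le> u'" "u' \<le> m" "u' = Suc u \<or> u = Suc u'"
    using g(2) unfolding edges_path_graph_iff by auto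
  have "v = 2 \<and> v' \<in> {1, 3} \<or> v' = 2 \<and> v \<in> {1, 3}"
    using g(3) unfolding edges_path_graph_iff by auto
  then show thesis
  proof
    assume "v = 2 \<and> v' \<in> {1, 3}"
    then show thesis using that[of u u' v'] g(1) u by blast
  next
    assume v: "v' = 2 \<and> v \<in> {1, 3}"
    have "g = {(u', v'), (u, v)}" unfolding g(1) by (rule insert_commute)
    then show thesis using that[of u' u v] u v by blast
  qed
qed

lemma edge_stripI:
  assumes "1 \<le> i" "i \<le> m" "1 \<le> j" "j \<le> m" "j = Suc i \<or> i = Suc j" "c \<in> {1, 3}"
  shows "{(i, 2), (j, c)} \<in> edges (categorical_product (path_graph m) (path_graph 3))"
proof -
  have "{i, j} \<in> edges (path_graph m)" "{2, c} \<in> edges (path_graph 3)"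
    using assms unfolding edges_path_graph_iff by auto
  then show ?thesis by (auto simp: categorical_product_def)
qed

lemma (in chain) in_lefts_iff:
  "g \<in> lefts b a \<longleftrightarrow> (\<exists>i. b \<le> i \<and> i < a \<and> (g = {x i, y i} \<or> g = {x i, z i}))"
  by (auto simp: lefts_def left_def)

lemma (in chain) in_rights_iff:
  "g \<in> rights a \<longleftrightarrow> (\<exists>i<a. g = {x i, y (Suc i)} \<or> g = {x i, z (Suc i)})"
  by (auto simp: rights_def right_def)

text \<open>The two components of the product are distinguished by the parity of the coordinate sum.\<close>

lemma even_strip_homotopy_equivalent:
  fixes n :: nat
  shows "geometric_realization
           (matching_complex (categorical_product (path_graph (2 * n + 2)) (path_graph 3)))
           homotopy_equivalent_space nsphere (2 * n + 1)"
proof -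
  define ex ey ez :: "nat \<Rightarrow> nat \<times> nat"
    where "ex i = (2 * i + 2, 2)" and "ey i = (2 * i + 1, 1)" and "ez i = (2 * i + 1, 3)" for i
  \<comment> \<open>The odd component is the mirror image of the even one under \<open>j\<close> to
    \<open>2 * n + 3 - j\<close>; numbered from the right, its chain too lacks just the last pair.
    Truncated subtraction makes these functions injective only on an initial range, hence the bound
    \<open>n\<close> in \<open>chain\<close>.\<close>
  define ox oy oz :: "nat \<Rightarrow> nat \<times> nat"
    where "ox i = (2 * n + 1 - 2 * i, 2)" and "oy i = (2 * n + 2 - 2 * i, 1)"
      and "oz i = (2 * n + 2 - 2 * i, 3)" for i
  note e_defs = ex_def ey_def ez_def and o_defs = ox_def oy_def oz_def
  interpret E: chain ex ey ez n
    by unfold_locales (auto simp: inj_on_def e_defs)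
  interpret O: chain ox oy oz n
    by unfold_locales (auto simp: inj_on_def o_defs)
  let ?S = "edges (categorical_product (path_graph (2 * n + 2)) (path_graph 3))"
  let ?E = "E.rights n \<union> E.lefts 0 (Suc n)" and ?O = "O.rights n \<union> O.lefts 0 (Suc n)"
  have S: "?S = ?E \<union> ?O"
  proof (intro equalityI subsetI)
    fix g assume "g \<in> ?S"
    then obtain i j c where g: "g = {(i, 2), (j, c)}" "1 \<le> i" "i \<le> 2 * n + 2" "1 \<le> j"
      "j \<le> 2 * n + 2" "j = Suc i \<or> i = Suc j" "c \<in> {1, 3}" by (rule edge_stripE)
    show "g \<in> ?E \<union> ?O"
    proof (cases "even i")
      case True
      define p where "p = i div 2 - 1"
      have i: "i = 2 * p + 2" using True g(2) by (auto simp: p_def elim!: evenE)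
      show ?thesis
      proof (cases "j = Suc i")
        case True
        then have "g \<in> E.rights n"
          using g i unfolding E.in_rights_iff e_defs by (intro exI[of _ p]) auto
        then show ?thesis by blast
      next
        case False
        then have "g \<in> E.lefts 0 (Suc n)"
          using g i unfolding E.in_lefts_iff e_defs by (intro exI[of _ p]) auto
        then show ?thesis by blast
      qed
    next
      case False
      define p where "p = n - i div 2"
      have i: "i = 2 * n + 1 - 2 * p" "p \<le> n" using False g(3) by (auto simp: p_def elim!: oddE)
      show ?thesis
      proof (cases "i = Suc j")
        case True
        then have "p < n" "j = 2 * n + 2 - 2 * Suc p" using i g(4) by auto
        then have "g \<in> O.rights n"
          using g i unfolding O.in_rights_iff o_defs by (intro exI[of _ p]) auto
        then show ?thesis by blast
      next
        case False
        then have "j = 2 * n + 2 - 2 * p" using i g(6) by auto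
        then have "g \<in> O.lefts 0 (Suc n)"
          using g i unfolding O.in_lefts_iff o_defs by (intro exI[of _ p]) auto
        then show ?thesis by blast
      qed
    qed
  next
    fix g assume "g \<in> ?E \<union> ?O"
    then show "g \<in> ?S"
      unfolding Un_iff E.in_rights_iff E.in_lefts_iff O.in_rights_iff O.in_lefts_iff e_defs o_defs
      by (auto intro!: edge_stripI)
  qed
  have par_E: "even (fst v + snd v)" if "g \<in> ?E" "v \<in> g" for g v
    using that unfolding Un_iff E.in_rights_iff E.in_lefts_iff e_defs by auto
  have par_O: "odd (fst v + snd v)" if "g \<in> ?O" "v \<in> g" for g v
    using that unfolding Un_iff O.in_rights_iff O.in_lefts_iff o_defs by auto
  have E_not_O: "ex i \<notin> g \<and> ey i \<notin> g \<and> ez i \<notin> g" if "g \<in> ?O" for g i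
    using par_O[OF that, of "ex i"] par_O[OF that, of "ey i"] par_O[OF that, of "ez i"]
    by (auto simp: e_defs)
  have O_not_E: "ox i \<notin> g \<and> oy i \<notin> g \<and> oz i \<notin> g" if "g \<in> ?E" "i \<le> n" for g i
    using par_E[OF that(1), of "ox i"] par_E[OF that(1), of "oy i"] par_E[OF that(1), of "oz i"] that(2)
    by (auto simp: o_defs)
  let ?LE = "E.lefts 0 (Suc n)" and ?LO = "O.lefts 0 (Suc n)"
  let ?K = "matchings (?LO \<union> ?LE)"
  have "fold_step\<^sup>*\<^sup>* (matchings ?S) (matchings (?LE \<union> ?O))"
    unfolding S using E_not_O by (intro E.folds_chain) auto
  moreover have "fold_step\<^sup>*\<^sup>* (matchings (?O \<union> ?LE)) ?K"
    using O_not_E by (intro O.folds_chain) auto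
  ultimately have folds: "fold_step\<^sup>*\<^sup>* (matchings ?S) ?K"
    unfolding Un_commute[of ?LE ?O] by (rule rtranclp_trans)
  have "finite ?S"
    unfolding S by (simp add: E.finite_lefts E.finite_rights O.finite_lefts O.finite_rights)
  then have K: "finite_complex ?K"
    "geometric_realization (matchings ?S) homotopy_equivalent_space geometric_realization ?K"
    using folds_homotopy_equivalent[OF folds] finite_complex_matchings by blast+
  have "critical_facets (matchings (?LE \<union> {})) (0 + (Suc n - 0)) 1"
    by (rule E.critical_facets_lefts[OF critical_facets_no_edges]) auto
  then have "critical_facets ?K (0 + (Suc n - 0) + (Suc n - 0)) 1"
    using O_not_E by (intro O.critical_facets_lefts) auto
  then have "critical_facets ?K (Suc (2 * n + 1)) 1"
    by (simp add: mult_2)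
  moreover have "card M \<le> Suc (2 * n + 1)" if "M \<in> ?K" for M
  proof -
    \<comment> \<open>Each component has folded to \<open>n + 1\<close> paths; their centres meet
      every edge, so no matching is larger than the critical facet.\<close>
    let ?C = "ex ` {..n} \<union> ox ` {..n}"
    have "card M \<le> card ?C"
      using that by (rule card_matching_le) (auto simp: E.in_lefts_iff O.in_lefts_iff)
    also have "card ?C \<le> card (ex ` {..n}) + card (ox ` {..n})"
      by (rule card_Un_le)
    also have "\<dots> \<le> Suc n + Suc n"
      using card_image_le[of "{..n}" ex] card_image_le[of "{..n}" ox] by simp
    finally show ?thesis by simp
  qed
  ultimately have "geometric_realization ?K homotopy_equivalent_space wedge_of_spheres 1 (2 * n + 1)"
    by (intro homotopy_equivalent_wedge_if_critical_facets[OF K(1)]) auto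
  also have "\<dots> homotopy_equivalent_space nsphere (2 * n + 1)"
    by (rule homeomorphic_imp_homotopy_equivalent_space[OF wedge_of_one_sphere])
  finally show ?thesis
    using homotopy_eqv_trans[OF K(2)] by (simp add: matching_complex_def matchings_def)
qed

lemma odd_strip_homotopy_equivalent:
  fixes n :: nat
  shows "geometric_realization
           (matching_complex (categorical_product (path_graph (2 * n + 3)) (path_graph 3)))
           homotopy_equivalent_space wedge_of_spheres (2 ^ (n + 2) - 1) (2 * n + 1)"
proof -
  define ex ey ez :: "nat \<Rightarrow> nat \<times> nat"
    where "ex i = (2 * i + 2, 2)" and "ey i = (2 * i + 1, 1)" and "ez i = (2 * i + 1, 3)" for i
  \<comment> \<open>Column 0 lies outside the strip: \<open>oy 0\<close> and \<open>oz 0\<close> are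
    dummies, and the left edges of the odd component start at index 1.\<close>
  define ox oy oz :: "nat \<Rightarrow> nat \<times> nat"
    where "ox i = (2 * i + 1, 2)" and "oy i = (2 * i, 1)" and "oz i = (2 * i, 3)" for i
  note e_defs = ex_def ey_def ez_def and o_defs = ox_def oy_def oz_def
  \<comment> \<open>The bound is \<open>Suc n\<close> because the pair with that index, in column
    \<open>2 * n + 3\<close>, is present, although \<open>ex (Suc n)\<close> lies beyond the
    strip.\<close>
  interpret E: chain ex ey ez "Suc n"
    by unfold_locales (auto simp: inj_on_def e_defs)
  interpret O: chain ox oy oz "Suc n"
    by unfold_locales (auto simp: inj_on_def o_defs)
  let ?S = "edges (categorical_product (path_graph (2 * n + 3)) (path_graph 3))"
  let ?E = "E.rights (Suc n) \<union> E.lefts 0 (Suc n)" and ?L = "O.lefts 1 (Suc (Suc n))"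
  let ?O = "O.rights (Suc n) \<union> ?L"
  have S: "?S = ?O \<union> ?E"
  proof (intro equalityI subsetI)
    fix g assume "g \<in> ?S"
    then obtain i j c where g: "g = {(i, 2), (j, c)}" "1 \<le> i" "i \<le> 2 * n + 3" "1 \<le> j"
      "j \<le> 2 * n + 3" "j = Suc i \<or> i = Suc j" "c \<in> {1, 3}" by (rule edge_stripE)
    show "g \<in> ?O \<union> ?E"
    proof (cases "even i")
      case True
      define p where "p = i div 2 - 1"
      have i: "i = 2 * p + 2" using True g(2) by (auto simp: p_def elim!: evenE)
      show ?thesis
      proof (cases "j = Suc i")
        case True
        then have "g \<in> E.rights (Suc n)"
          using g i unfolding E.in_rights_iff e_defs by (intro exI[of _ p]) auto
        then show ?thesis by blast
      next
        case False
        then have "g \<in> E.lefts 0 (Suc n)"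
          using g i unfolding E.in_lefts_iff e_defs by (intro exI[of _ p]) auto
        then show ?thesis by blast
      qed
    next
      case False
      define p where "p = i div 2"
      have i: "i = 2 * p + 1" using False by (auto simp: p_def elim!: oddE)
      show ?thesis
      proof (cases "j = Suc i")
        case True
        then have "g \<in> O.rights (Suc n)"
          using g i unfolding O.in_rights_iff o_defs by (intro exI[of _ p]) auto
        then show ?thesis by blast
      next
        case False
        then have "g \<in> ?L"
          using g i unfolding O.in_lefts_iff o_defs by (intro exI[of _ p]) auto
        then show ?thesis by blast
      qed
    qed
  next
    fix g assume "g \<in> ?O \<union> ?E"
    then show "g \<in> ?S"
      unfolding Un_iff E.in_rights_iff E.in_lefts_iff O.in_rights_iff O.in_lefts_iff e_defs o_defs
      by (auto intro!: edge_stripI)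
  qed
  have par_E: "even (fst v + snd v)" if "g \<in> ?E" "v \<in> g" for g v
    using that unfolding Un_iff E.in_rights_iff E.in_lefts_iff e_defs by auto
  have par_O: "odd (fst v + snd v)" if "g \<in> ?O" "v \<in> g" for g v
    using that unfolding Un_iff O.in_rights_iff O.in_lefts_iff o_defs by auto
  have E_not_O: "ex i \<notin> g \<and> ey i \<notin> g \<and> ez i \<notin> g" if "g \<in> ?O" for g i
    using par_O[OF that, of "ex i"] par_O[OF that, of "ey i"] par_O[OF that, of "ez i"]
    by (auto simp: e_defs)
  have O_not_E: "ox i \<notin> g \<and> oy i \<notin> g \<and> oz i \<notin> g" if "g \<in> ?E" for g i
    using par_E[OF that, of "ox i"] par_E[OF that, of "oy i"] par_E[OF that, of "oz i"]
    by (auto simp: o_defs)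
  let ?K = "matchings (?E \<union> ?L)"
  have "fold_step\<^sup>*\<^sup>* (matchings (?O \<union> ?E)) (matchings (?L \<union> ?E))"
    using O_not_E by (intro O.folds_chain) auto
  then have folds: "fold_step\<^sup>*\<^sup>* (matchings ?S) ?K"
    unfolding S Un_commute[of ?L ?E] .
  have "finite ?S"
    unfolding S by (simp add: E.finite_lefts E.finite_rights O.finite_lefts O.finite_rights)
  then have K: "finite_complex ?K"
    "geometric_realization (matchings ?S) homotopy_equivalent_space geometric_realization ?K"
    using folds_homotopy_equivalent[OF folds] finite_complex_matchings by blast+
  \<comment> \<open>The \<open>n + 1\<close> isolated paths of the odd component serve as the
    \<open>R\<close> with one critical facet beside which the full chain is counted.\<close>
  have "critical_facets (matchings (?L \<union> {})) (0 + (Suc (Suc n) - 1)) 1"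
    by (rule O.critical_facets_lefts[OF critical_facets_no_edges]) auto
  then have "critical_facets ?K (0 + (Suc (Suc n) - 1) + Suc n) (2 ^ (Suc n + 1) - 1)"
    using E_not_O by (intro E.critical_facets_full_chain) auto
  then have "critical_facets ?K (Suc (2 * n + 1)) (2 ^ (n + 2) - 1)"
    by (simp add: mult_2)
  moreover have "card M \<le> Suc (2 * n + 1)" if "M \<in> ?K" for M
  proof -
    \<comment> \<open>\<open>ox 0\<close> lies on no edge that is left after folding; including it
      would exceed the bound by one.\<close>
    let ?C = "ex ` {..n} \<union> ox ` {1..Suc n}"
    have "card M \<le> card ?C"
      using that
      by (rule card_matching_le) (auto simp: E.in_lefts_iff E.in_rights_iff O.in_lefts_iff)
    also have "card ?C \<le> card (ex ` {..n}) + card (ox ` {1..Suc n})"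
      by (rule card_Un_le)
    also have "\<dots> \<le> Suc n + Suc n"
      using card_image_le[of "{..n}" ex] card_image_le[of "{1..Suc n}" ox] by simp
    finally show ?thesis by simp
  qed
  moreover have "0 < (2::nat) ^ (n + 2) - 1"
    using one_less_power[of "2::nat" "n + 2"] by simp
  ultimately have "geometric_realization ?K homotopy_equivalent_space
      wedge_of_spheres (2 ^ (n + 2) - 1) (2 * n + 1)"
    by (intro homotopy_equivalent_wedge_if_critical_facets[OF K(1)])
  then show ?thesis
    using homotopy_eqv_trans[OF K(2)] by (simp add: matching_complex_def matchings_def)
qed

theorem theorem5p5:
  fixes n :: nat
  shows "geometric_realization
           (matching_complex (categorical_product (path_graph (2 * n + 2)) (path_graph 3)))
           homotopy_equivalent_space nsphere (2 * n + 1) \<and>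
         geometric_realization
           (matching_complex (categorical_product (path_graph (2 * n + 3)) (path_graph 3)))
           homotopy_equivalent_space wedge_of_spheres (2 ^ (n + 2) - 1) (2 * n + 1)"
  using even_strip_homotopy_equivalent odd_strip_homotopy_equivalent by blast

end
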